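(* Let $\mathcal S$ be a locally compact $T_4$ space, and let $\mu$ be a content on $\mathfrak R(\mathcal S)$. There is a unique Radon measure $\nu$ on $\mathcal S$ such that $$\fint_{\mathcal S}f\,d\mu=\int_{\mathcal S}f\,d\nu\qquad\text{for all } f\in\mathcal C_0(\mathcal S,\mathbb R).$$ Furthermore, there is a unique liminal density structure $\{\phi_R\}_{R\in\mathfrak R(\mathcal S)}$ subordinate to $\nu$ such that $$\mu[R]=\nu(R)+\int_{\partial R}\phi_R\,d\nu\qquad\text{for all }R\in\mathfrak R_0(\mathcal S),$$ while $$\fint_R f\,d\mu=\int_R f\,d\nu+\int_{\partial R}f\,\phi_R\,d\nu\qquad( * )$$ for all $f\in\mathcal C_0(\mathcal S,\mathbb R)$ and $R\in\mathfrak R(\mathcal S)$. Also, $( * )$ holds for all continuous $f:\mathcal S\to\mathbb R$ and all $R\in\mathfrak R_0(\mathcal S)$.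
   Context: A $T_4$ space is a Hausdorff space in which any two disjoint closed sets have disjoint open neighbourhoods. $\mathcal C_0(\mathcal S,\mathbb R)$ is the space of bounded continuous $f:\mathcal S\to\mathbb R$ vanishing at infinity: for every $\epsilon>0$ there is a compact $K\subseteq\mathcal S$ with $|f|\le\epsilon$ off $K$. $\partial R$ denotes the topological boundary of $R$. An open set $R\subseteq\mathcal S$ is regular if $R=\mathrm{int}(\mathrm{clos}(R))$. $\mathfrak R(\mathcal S)$ is the set of regular open subsets; it is a Boolean algebra with meet $\cap$, join $Q\vee R:=\mathrm{int}(\mathrm{clos}(Q\cup R))$ and complement $\neg R:=\mathrm{int}(\mathcal S\setminus R)$. $\mathfrak R_0(\mathcal S)$ is the set of regular open subsets of $\mathcal S$ with compact closure. A content on $\mathfrak R(\mathcal S)$ is a function $\mu:\mathfrak R(\mathcal S)\to[0,\infty)$ such that $\mu[R_1\vee\cdots\vee R_N]=\sum_n\mu[R_n]$ for every finite collection of disjoint regular open sets; by standing assumption $\mu[\mathcal S]=1$. A regular partition of $\mathcal S$ is a finite collection of disjoint elements of $\mathfrak R(\mathcal S)$ with join $\mathcal S$. Integral against a content: call $f:\mathcal S\to\mathbb R$ simple if it is constant on each cell of some regular partition of $\mathcal S$ (values off the cells are arbitrary). For $R\in\mathfrak R(\mathcal S)$ and bounded simple $f$ with value $r_n$ on the cell $P_n$, $\fint_R f\,d\mu:=\sum_n r_n\mu[P_n\cap R]$. Every bounded continuous $g:\mathcal S\to\mathbb R$ is a uniform limit of simple functions, and $\fint_R g\,d\mu$ is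 the supremum of $\fint_R f\,d\mu$ over all bounded simple $f$ with $f\le g$ on $R$. This depends only on $g|_R$; so if $f$ is continuous, possibly unbounded, and $R$ has compact closure, then $\fint_R f\,d\mu$ means $\fint_R g\,d\mu$ for any bounded continuous $g$ on $\mathcal S$ with $g|_R=f|_R$ (e.g. a truncation of $f$). A Borel measure $\nu$ on $\mathcal S$ is Radon if for every Borel set $B$, $\nu[B]=\sup\{\nu[K]: K\subseteq B,\ K\text{ compact}\}$ and $\nu[B]=\inf\{\nu[O]: B\subseteq O,\ O\text{ open}\}$. Given a Borel measure $\nu$ on $\mathcal S$, a liminal density structure subordinate to $\nu$ is a collection $\{\phi_R\}_{R\in\mathfrak R(\mathcal S)}$, where $\phi_R\in L^1(\partial R,\nu;[0,1])$ is (the $\nu$-a.e. class of) a $[0,1]$-valued $\nu$-integrable function on $\partial R$, such that for every regular partition $\{R_1,\dots,R_N\}$ of $\mathcal S$, $\phi_{R_1}+\cdots+\phi_{R_N}=1$ $\nu$-almost everywhere on $\partial R_1\cup\cdots\cup\partial R_N$ (each $\phi_{R_n}$ being extended by $0$ off $\partial R_n$). *)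

theory Defs
  imports "HOL-Analysis.Analysis"
begin

section \<open>Regular open sets, contents and regular partitions\<close>

definition regular_open :: "'a::topological_space set \<Rightarrow> bool" where
  "regular_open R \<longleftrightarrow> interior (closure R) = R"

definition precompact_regular_open :: "'a::topological_space set \<Rightarrow> bool" where
  "precompact_regular_open R \<longleftrightarrow> regular_open R \<and> compact (closure R)"

definition regular_join :: "'a::topological_space set set \<Rightarrow> 'a set" where
  "regular_join \<R> = interior (closure (\<Union>\<R>))"

text \<open>On finite collections, \<open>regular_join\<close> is the iterated binary join
  of the Boolean algebra of regular open sets.\<close>

lemma regular_join_singleton: "regular_open R \<Longrightarrow> regular_join {R} = R"
  by (simp add: regular_join_def regular_open_def)

lemma regular_join_insert:
  assumes "\<And>P. P \<in> \<R> \<Longrightarrow> regular_open P"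
  shows "regular_join (insert Q \<R>) = regular_join {Q, regular_join \<R>}"
proof -
  have "open P" if "P \<in> \<R>" for P
    using assms[OF that] open_interior[of "closure P"] by (simp add: regular_open_def)
  then have "open (\<Union>\<R>)" by blast
  then have "\<Union>\<R> \<subseteq> regular_join \<R>"
    by (simp add: regular_join_def closure_subset interior_maximal)
  moreover have "regular_join \<R> \<subseteq> closure (\<Union>\<R>)"
    by (simp add: regular_join_def interior_subset)
  ultimately have "closure (regular_join \<R>) = closure (\<Union>\<R>)"
    by (metis closure_closure closure_mono subset_antisym)
  then show ?thesis
    by (simp add: regular_join_def closure_Un)
qed

text \<open>A content is a total function; its values off the regular open sets are irrelevant.\<close>

definition regular_content :: "('a::topological_space set \<Rightarrow> real) \<Rightarrow> bool" where
  "regular_content \<mu> \<longleftrightarrow>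
     (\<forall>R. regular_open R \<longrightarrow> 0 \<le> \<mu> R) \<and>
     (\<forall>\<R>. finite \<R> \<longrightarrow> (\<forall>R\<in>\<R>. regular_open R) \<longrightarrow> disjoint \<R> \<longrightarrow>
        \<mu> (regular_join \<R>) = (\<Sum>R\<in>\<R>. \<mu> R))"

definition regular_partition :: "'a::topological_space set set \<Rightarrow> bool" where
  "regular_partition \<P> \<longleftrightarrow>
     finite \<P> \<and> (\<forall>P\<in>\<P>. regular_open P) \<and> disjoint \<P> \<and> regular_join \<P> = UNIV"

section \<open>Integration against a content\<close>

definition regular_simple :: "('a::topological_space \<Rightarrow> real) \<Rightarrow> bool" where
  "regular_simple f \<longleftrightarrow> (\<exists>\<P>. regular_partition \<P> \<and> (\<forall>P\<in>\<P>. f constant_on P))"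

text \<open>For a content \<open>\<mu>\<close>, a regular open \<open>R\<close> and a simple \<open>f\<close>, the sum below does not
  depend on the partition (pass to a common refinement), nor on the value \<open>r P\<close> chosen at
  an empty cell, since a content vanishes there.\<close>

definition simple_content_integral ::
    "('a::topological_space set \<Rightarrow> real) \<Rightarrow> 'a set \<Rightarrow> ('a \<Rightarrow> real) \<Rightarrow> real" where
  "simple_content_integral \<mu> R f =
     (THE I. \<exists>\<P> r. regular_partition \<P> \<and> (\<forall>P\<in>\<P>. \<forall>x\<in>P. f x = r P) \<and>
        I = (\<Sum>P\<in>\<P>. r P * \<mu> (P \<inter> R)))"

definition content_integral ::
    "('a::topological_space set \<Rightarrow> real) \<Rightarrow> 'a set \<Rightarrow> ('a \<Rightarrow> real) \<Rightarrow> real" where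
  "content_integral \<mu> R g =
     Sup {simple_content_integral \<mu> R f | f.
            bounded (range f) \<and> regular_simple f \<and> (\<forall>x\<in>R. f x \<le> g x)}"

text \<open>The integral over \<open>R\<close> only sees the integrand on \<open>R\<close>. Hence, for a continuous and
  possibly unbounded \<open>f\<close> and an \<open>R\<close> with compact closure, \<open>content_integral \<mu> R f\<close> is already
  the integral of any bounded continuous function agreeing with \<open>f\<close> on \<open>R\<close>, and such
  functions exist (truncate \<open>f\<close>).\<close>

lemma content_integral_cong:
  assumes "\<And>x. x \<in> R \<Longrightarrow> f x = g x"
  shows "content_integral \<mu> R f = content_integral \<mu> R g"
proof -
  have "(\<forall>x\<in>R. h x \<le> f x) \<longleftrightarrow> (\<forall>x\<in>R. h x \<le> g x)" for h
    using assms by auto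
  then show ?thesis
    by (simp add: content_integral_def)
qed

lemma exists_bounded_continuous_agreeing:
  fixes f :: "'a::topological_space \<Rightarrow> real"
  assumes f: "continuous_on UNIV f" and R: "compact (closure R)"
  shows "\<exists>g. continuous_on UNIV g \<and> bounded (range g) \<and> (\<forall>x\<in>R. g x = f x)"
proof -
  have "compact (f ` closure R)"
    using f R continuous_on_subset compact_continuous_image by blast
  then obtain M where M: "\<And>x. x \<in> closure R \<Longrightarrow> \<bar>f x\<bar> \<le> M"
    by (metis bounded_iff compact_imp_bounded imageI real_norm_def)
  define g where "g = (\<lambda>x. max (- \<bar>M\<bar>) (min \<bar>M\<bar> (f x)))"
  have "continuous_on UNIV g"
    unfolding g_def using f by (intro continuous_intros)
  moreover have "bounded (range g)"
    unfolding bounded_iff by (rule exI[of _ "\<bar>M\<bar>"]) (auto simp: g_def)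
  moreover have "g x = f x" if "x \<in> R" for x
    using M[of x] that closure_subset[of R] by (auto simp: g_def)
  ultimately show ?thesis by blast
qed

section \<open>Function space, Radon measures and liminal density structures\<close>

definition C0_space :: "('a::topological_space \<Rightarrow> real) set" where
  "C0_space = {f. continuous_on UNIV f \<and> bounded (range f) \<and>
     (\<forall>\<epsilon>>0. \<exists>K. compact K \<and> (\<forall>x. x \<notin> K \<longrightarrow> \<bar>f x\<bar> \<le> \<epsilon>))}"

definition radon_measure :: "'a::topological_space measure \<Rightarrow> bool" where
  "radon_measure \<nu> \<longleftrightarrow> sets \<nu> = sets borel \<and>
     (\<forall>B\<in>sets borel.
        emeasure \<nu> B = (SUP K\<in>{K. K \<subseteq> B \<and> compact K}. emeasure \<nu> K) \<and>
        emeasure \<nu> B = (INF U\<in>{U. B \<subseteq> U \<and> open U}. emeasure \<nu> U))"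

text \<open>Integrability is required explicitly because the Bochner integral of a
  non-integrable function is \<open>0\<close> by convention. On a locally compact Hausdorff space it
  forces a representing Radon measure to be finite.\<close>

definition represents_content ::
    "'a::topological_space measure \<Rightarrow> ('a set \<Rightarrow> real) \<Rightarrow> bool" where
  "represents_content \<nu> \<mu> \<longleftrightarrow>
     (\<forall>f\<in>C0_space. integrable \<nu> f \<and> content_integral \<mu> UNIV f = (\<integral>x. f x \<partial>\<nu>))"

text \<open>\<open>\<phi> R\<close> represents a class in \<open>L\<^sup>1(\<partial>R, \<nu>; [0,1])\<close>; its values off \<open>frontier R\<close> are
  irrelevant, and the indicator is the extension by \<open>0\<close>.\<close>

definition liminal_density_structure ::
    "'a::topological_space measure \<Rightarrow> ('a set \<Rightarrow> 'a \<Rightarrow> real) \<Rightarrow> bool" where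
  "liminal_density_structure \<nu> \<phi> \<longleftrightarrow>
     (\<forall>R. regular_open R \<longrightarrow>
        set_integrable \<nu> (frontier R) (\<phi> R) \<and> (\<forall>x\<in>frontier R. \<phi> R x \<in> {0..1})) \<and>
     (\<forall>\<P>. regular_partition \<P> \<longrightarrow>
        (AE x in \<nu>. x \<in> (\<Union>R\<in>\<P>. frontier R) \<longrightarrow>
           (\<Sum>R\<in>\<P>. indicator (frontier R) x * \<phi> R x) = 1))"

text \<open>Equality of the \<open>\<nu>\<close>-a.e. classes of \<open>\<phi> R\<close> and \<open>\<psi> R\<close> on the boundary of every
  regular open \<open>R\<close>.\<close>

definition liminal_equal ::
    "'a::topological_space measure \<Rightarrow> ('a set \<Rightarrow> 'a \<Rightarrow> real) \<Rightarrow> ('a set \<Rightarrow> 'a \<Rightarrow> real) \<Rightarrow> bool"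
  where
  "liminal_equal \<nu> \<phi> \<psi> \<longleftrightarrow>
     (\<forall>R. regular_open R \<longrightarrow> (AE x in \<nu>. x \<in> frontier R \<longrightarrow> \<phi> R x = \<psi> R x))"

definition liminal_formula ::
    "('a::topological_space set \<Rightarrow> real) \<Rightarrow> 'a measure \<Rightarrow> ('a set \<Rightarrow> 'a \<Rightarrow> real) \<Rightarrow>
     ('a \<Rightarrow> real) \<Rightarrow> 'a set \<Rightarrow> bool" where
  "liminal_formula \<mu> \<nu> \<phi> f R \<longleftrightarrow>
     content_integral \<mu> R f = (LINT x:R|\<nu>. f x) + (LINT x:frontier R|\<nu>. f x * \<phi> R x)"

definition liminal_representation ::
    "('a::topological_space set \<Rightarrow> real) \<Rightarrow> 'a measure \<Rightarrow> ('a set \<Rightarrow> 'a \<Rightarrow> real) \<Rightarrow> bool" where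
  "liminal_representation \<mu> \<nu> \<phi> \<longleftrightarrow>
     liminal_density_structure \<nu> \<phi> \<and>
     (\<forall>R. precompact_regular_open R \<longrightarrow>
        \<mu> R = measure \<nu> R + (LINT x:frontier R|\<nu>. \<phi> R x)) \<and>
     (\<forall>f\<in>C0_space. \<forall>R. regular_open R \<longrightarrow> liminal_formula \<mu> \<nu> \<phi> f R)"

end

theory Submission
  imports Defs
begin

text \<open>On an open set \<open>U\<close> the measure \<open>\<nu>\<close> is the supremum of \<open>\<mu> R\<close> over regular open \<open>R\<close> whose closure
  is a compact subset of \<open>U\<close>; normality makes this subadditive, so that Caratheodory's construction
  applies, and a layer-cake argument identifies the two integrals. For a regular open \<open>R\<close> the
  restriction \<open>Q \<mapsto> \<mu> (Q \<inter> R)\<close> is again a content, hence represented by a Radon measure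
  \<open>\<nu>\<^sub>R \<le> \<nu>\<close> with a density \<open>g\<^sub>R\<close> with values in \<open>[0,1]\<close>. Over a regular partition the
  contents add up, so the densities sum to \<open>1\<close>; as \<open>\<nu>\<^sub>R\<close> does not charge the exterior of \<open>R\<close>,
  the density is \<open>1\<close> on \<open>R\<close> and \<open>0\<close> outside \<open>closure R\<close>, and its restriction to
  \<open>frontier R\<close> is the liminal density.\<close>

section \<open>Regular open sets and partitions\<close>

text \<open>A content is additive for the join, and the join absorbs frontiers. So
  \<open>\<mu>\<close> itself need not be the trace of any measure: on the real line, an ultrafilter
  of regular open sets that contains every interval (0, d) defines a content with value 1 on (0, 1),
  although its measure \<open>\<nu>\<close> is the point mass at 0. The content decides to which
  sides frontier mass belongs, and the liminal densities record these shares. Content can also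
  escape to infinity, so \<open>\<nu>\<close> may have smaller total mass than \<open>\<mu>\<close>;
  this is why the test functions vanish at infinity. What links the two is a sandwich: an open
  subset of a regular open \<open>R\<close> has measure at most \<open>\<mu> R\<close>, and
  \<open>\<mu> R\<close> is at most the measure of \<open>closure R\<close> if this closure is
  compact. The comparison of integrals rests on these two bounds. Comparison of measures, in turn,
  always goes through Urysohn functions in \<open>C0_space\<close>, which separate a compact set
  from the complement of an open neighbourhood.\<close>

lemma regular_open_imp_open: "regular_open R \<Longrightarrow> open R"
  by (metis open_interior regular_open_def)

lemma regular_open_UNIV: "regular_open UNIV"
  and regular_open_empty: "regular_open {}"
  by (simp_all add: regular_open_def)

lemma regular_open_interior_closure: "regular_open (interior (closure A))"
  unfolding regular_open_def
proof (rule subset_antisym)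
  have "closure (interior (closure A)) \<subseteq> closure A"
    by (simp add: closure_minimal interior_subset)
  then show "interior (closure (interior (closure A))) \<subseteq> interior (closure A)"
    by (rule interior_mono)
  show "interior (closure A) \<subseteq> interior (closure (interior (closure A)))"
    by (simp add: closure_subset interior_maximal)
qed

lemma regular_open_Int:
  assumes "regular_open A" "regular_open B"
  shows "regular_open (A \<inter> B)"
  unfolding regular_open_def
proof (rule subset_antisym)
  show "interior (closure (A \<inter> B)) \<subseteq> A \<inter> B"
    using assms interior_mono[OF closure_mono[of "A \<inter> B" A]]
      interior_mono[OF closure_mono[of "A \<inter> B" B]]
    by (auto simp: regular_open_def)
  show "A \<inter> B \<subseteq> interior (closure (A \<inter> B))"
    using assms by (simp add: closure_subset interior_maximal open_Int regular_open_imp_open)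
qed

lemma regular_open_Compl_closure: "regular_open R \<Longrightarrow> regular_open (- closure R)"
  unfolding regular_open_def closure_complement interior_complement by simp

lemma regular_open_eq_Compl_closure_Compl_closure:
  "regular_open R \<Longrightarrow> - closure (- closure R) = R"
  unfolding regular_open_def closure_complement by simp

text \<open>The interior of a set is the whole space only if the set is, so the join condition
  amounts to density of the union; later arguments use it in this form.\<close>

lemma regular_partition_iff:
  "regular_partition \<P> \<longleftrightarrow>
     finite \<P> \<and> (\<forall>P\<in>\<P>. regular_open P) \<and> disjoint \<P> \<and> closure (\<Union>\<P>) = UNIV"
  using interior_subset by (fastforce simp: regular_partition_def regular_join_def)

lemma regular_partition_complement:
  assumes "regular_open R"
  shows "regular_partition {R, - closure R}"
proof -
  have "closure R \<union> closure (- closure R) = UNIV"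
    using closure_subset[of "- closure R"] by blast
  then show ?thesis
    using assms regular_open_Compl_closure[OF assms] subsetD[OF closure_subset[of R]]
    by (auto simp: regular_partition_iff disjoint_def closure_Un)
qed

text \<open>The partition \<open>{R, - closure R}\<close> is a set of cells; it would collapse to
  one element if both coincided, and sums over it could not be split. Coincidence would force
  \<open>R\<close> to be empty, but the exterior of the empty set is the whole space.\<close>

lemma neq_Compl_closure: "R \<noteq> - closure R"
proof
  assume "R = - closure R"
  then have "x \<notin> R" for x
    using closure_subset[of R] by (metis ComplD subsetD)
  then have "R = {}"
    by blast
  with \<open>R = - closure R\<close> show False
    by simp
qed

text \<open>A dense set approaches each point of an open set from inside that open set. Hence
  cutting the cells of a partition by an open \<open>R\<close>, or by the cells of a second
  partition, preserves density.\<close>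

lemma closure_dense_open_Int:
  assumes "closure D = UNIV" "open R"
  shows "closure (D \<inter> R) = closure R"
  using open_Int_closure_subset[OF assms(2), of D] assms(1)
  by (metis Int_UNIV_right Int_commute Int_lower2 closure_closure closure_mono subset_antisym)

lemma regular_partition_refinement:
  assumes P: "regular_partition \<P>" and Q: "regular_partition \<Q>"
  shows "regular_partition ((\<lambda>(A,B). A \<inter> B) ` (\<P> \<times> \<Q>))"
proof -
  have U: "\<Union>((\<lambda>(A,B). A \<inter> B) ` (\<P> \<times> \<Q>)) = \<Union>\<P> \<inter> \<Union>\<Q>"
    by auto
  have "open (\<Union>\<Q>)"
    using Q by (auto simp: regular_partition_iff regular_open_imp_open)
  then have "closure (\<Union>\<P> \<inter> \<Union>\<Q>) = UNIV"
    using closure_dense_open_Int[of "\<Union>\<P>" "\<Union>\<Q>"] P Q by (simp add: regular_partition_iff)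
  moreover have "disjoint ((\<lambda>(A,B). A \<inter> B) ` (\<P> \<times> \<Q>))"
    using P Q unfolding regular_partition_iff disjoint_def by blast
  moreover have "\<forall>C\<in>(\<lambda>(A,B). A \<inter> B) ` (\<P> \<times> \<Q>). regular_open C"
    using P Q by (auto simp: regular_partition_iff regular_open_Int)
  ultimately show ?thesis
    using P Q unfolding regular_partition_iff U by blast
qed

text \<open>An open cell disjoint from \<open>P\<close> also misses \<open>closure P\<close>.
  Consequently, at a frontier point of some cell, every cell either has the point on its own
  frontier or has it outside its closure.\<close>

lemma regular_partition_frontier_notin:
  assumes "regular_partition \<P>" "P \<in> \<P>" "Q \<in> \<P>" "x \<in> frontier P"
  shows "x \<notin> Q"
proof
  assume "x \<in> Q"
  have op: "open P" "open Q"
    using assms by (auto simp: regular_partition_iff regular_open_imp_open)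
  then have "P \<noteq> Q"
    using assms \<open>x \<in> Q\<close> by (auto simp: frontier_def interior_open)
  then have "P \<inter> Q = {}"
    using assms by (auto simp: regular_partition_iff disjoint_def)
  then have "closure P \<inter> Q = {}"
    using op by (metis Int_commute open_Int_closure_eq_empty)
  then show False
    using assms \<open>x \<in> Q\<close> by (auto simp: frontier_def)
qed

section \<open>Contents\<close>

lemma content_nonneg: "regular_content \<mu> \<Longrightarrow> regular_open R \<Longrightarrow> 0 \<le> \<mu> R"
  by (simp add: regular_content_def)

lemma content_empty:
  assumes "regular_content \<mu>"
  shows "\<mu> {} = 0"
proof -
  have "\<mu> (regular_join {}) = (\<Sum>R\<in>{}. \<mu> R)"
    using assms[unfolded regular_content_def, THEN conjunct2, rule_format, of "{}"]
    by (simp add: disjoint_def)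
  then show ?thesis by (simp add: regular_join_def)
qed

text \<open>Passing from a family to its set of values is harmless: repeated members of a disjoint
  family are empty and have content \<open>0\<close>.\<close>

lemma content_join_image:
  assumes \<mu>: "regular_content \<mu>" and fin: "finite I"
    and reg: "\<And>i. i \<in> I \<Longrightarrow> regular_open (F i)" and disj: "disjoint_family_on F I"
  shows "\<mu> (interior (closure (\<Union>i\<in>I. F i))) = (\<Sum>i\<in>I. \<mu> (F i))"
proof -
  have "disjoint (F ` I)"
    using disj unfolding disjoint_def disjoint_family_on_def by fast
  then have "\<mu> (interior (closure (\<Union>i\<in>I. F i))) = sum \<mu> (F ` I)"
    using \<mu> fin reg unfolding regular_content_def regular_join_def
    by (metis (no_types, lifting) finite_imageI imageE)
  also have "\<dots> = (\<Sum>i\<in>I. \<mu> (F i))"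
  proof (rule sum.reindex_nontrivial[OF fin, of F \<mu>, unfolded comp_def])
    fix i j assume "i \<in> I" "j \<in> I" "i \<noteq> j" "F i = F j"
    then have "F i = {}"
      using disjoint_family_onD[OF disj, of i j] by simp
    then show "\<mu> (F i) = 0"
      by (simp add: content_empty[OF \<mu>])
  qed
  finally show ?thesis .
qed

text \<open>Cut down to \<open>R\<close>, the cells still have a union dense in \<open>R\<close>, so
  by regularity the join of the pieces is \<open>R\<close> itself.\<close>

lemma content_partition:
  assumes \<mu>: "regular_content \<mu>" and P: "regular_partition \<P>" and R: "regular_open R"
  shows "(\<Sum>P\<in>\<P>. \<mu> (P \<inter> R)) = \<mu> R"
proof -
  have "disjoint_family_on (\<lambda>P. P \<inter> R) \<P>"
    using P by (auto simp: regular_partition_iff disjoint_def disjoint_family_on_def)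
  then have "\<mu> (interior (closure (\<Union>P\<in>\<P>. P \<inter> R))) = (\<Sum>P\<in>\<P>. \<mu> (P \<inter> R))"
    using content_join_image[OF \<mu>, of \<P> "\<lambda>P. P \<inter> R"] P R
    by (simp add: regular_partition_iff regular_open_Int)
  moreover have "closure (\<Union>P\<in>\<P>. P \<inter> R) = closure R"
    using P R closure_dense_open_Int[of "\<Union>\<P>" R]
    by (simp add: regular_partition_iff regular_open_imp_open)
  ultimately show ?thesis
    using R by (simp add: regular_open_def)
qed

lemma content_split:
  assumes \<mu>: "regular_content \<mu>" and "regular_open Q" and "regular_open R"
  shows "\<mu> R = \<mu> (Q \<inter> R) + \<mu> (- closure Q \<inter> R)"
  unfolding content_partition[OF \<mu> regular_partition_complement[OF assms(2)] assms(3), symmetric]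
  by (subst sum.insert) (use neq_Compl_closure[of Q] in auto)

lemma content_mono:
  assumes \<mu>: "regular_content \<mu>" and "regular_open Q" "regular_open R" "Q \<subseteq> R"
  shows "\<mu> Q \<le> \<mu> R"
proof -
  have "0 \<le> \<mu> (- closure Q \<inter> R)"
    using assms by (intro content_nonneg regular_open_Int regular_open_Compl_closure)
  then show ?thesis
    using content_split[OF \<mu> assms(2,3)] by (simp add: inf.absorb1[OF assms(4)])
qed

lemma regular_content_restrict:
  assumes \<mu>: "regular_content \<mu>" and R: "regular_open R"
  shows "regular_content (\<lambda>Q. \<mu> (Q \<inter> R))"
  unfolding regular_content_def
proof (intro conjI allI impI)
  show "0 \<le> \<mu> (Q \<inter> R)" if "regular_open Q" for Q
    using \<mu> R that by (intro content_nonneg regular_open_Int)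
next
  fix \<R> :: "'a set set"
  assume fin: "finite \<R>" and reg: "\<forall>Q\<in>\<R>. regular_open Q" and "disjoint \<R>"
  then have "disjoint_family_on (\<lambda>Q. Q \<inter> R) \<R>"
    by (auto simp: disjoint_def disjoint_family_on_def)
  then have "(\<Sum>Q\<in>\<R>. \<mu> (Q \<inter> R)) = \<mu> (interior (closure (\<Union>\<R> \<inter> R)))"
    using content_join_image[OF \<mu> fin, of "\<lambda>Q. Q \<inter> R"] R reg
    unfolding Int_Union2 by (simp only: regular_open_Int)
  \<comment> \<open>The distributive law of the Boolean algebra: the open set \<open>R\<close> meets
    the closure of the union only inside the closure of its trace on the union.\<close>
  moreover have "interior (closure (\<Union>\<R> \<inter> R)) = regular_join \<R> \<inter> R"
  proof (rule subset_antisym)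
    show "interior (closure (\<Union>\<R> \<inter> R)) \<subseteq> regular_join \<R> \<inter> R"
      using R interior_mono[OF closure_mono[of "\<Union>\<R> \<inter> R" R]]
        interior_mono[OF closure_mono[of "\<Union>\<R> \<inter> R" "\<Union>\<R>"]]
      unfolding regular_join_def regular_open_def by blast
    have "R \<inter> closure (\<Union>\<R>) \<subseteq> closure (\<Union>\<R> \<inter> R)"
      using open_Int_closure_subset[of R "\<Union>\<R>"] R by (simp add: regular_open_imp_open Int_commute)
    then have "regular_join \<R> \<inter> R \<subseteq> closure (\<Union>\<R> \<inter> R)"
      using interior_subset[of "closure (\<Union>\<R>)"] by (auto simp: regular_join_def)
    then show "regular_join \<R> \<inter> R \<subseteq> interior (closure (\<Union>\<R> \<inter> R))"
      using R by (intro interior_maximal) (auto simp: regular_join_def regular_open_imp_open)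
  qed
  ultimately show "\<mu> (regular_join \<R> \<inter> R) = (\<Sum>Q\<in>\<R>. \<mu> (Q \<inter> R))"
    by simp
qed

section \<open>The integral against a content\<close>

text \<open>The common-refinement argument, written as a double sum over pairs of cells. Empty
  intersections have content \<open>0\<close>, so values are compared only where two cells meet
  inside \<open>R\<close>. With equal values in both directions it yields independence of the
  partition; with inequalities it bounds simple minorants.\<close>

lemma content_sum_le:
  assumes \<mu>: "regular_content \<mu>" and R: "regular_open R"
    and P: "regular_partition \<P>" and Q: "regular_partition \<Q>"
    and le: "\<And>P Q. P \<in> \<P> \<Longrightarrow> Q \<in> \<Q> \<Longrightarrow> P \<inter> Q \<inter> R \<noteq> {} \<Longrightarrow> r P \<le> s Q"
  shows "(\<Sum>P\<in>\<P>. r P * \<mu> (P \<inter> R)) \<le> (\<Sum>Q\<in>\<Q>. s Q * \<mu> (Q \<inter> R))"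
proof -
  have regP: "regular_open P" if "P \<in> \<P>" for P
    using P that by (simp add: regular_partition_iff)
  have regQ: "regular_open Q" if "Q \<in> \<Q>" for Q
    using Q that by (simp add: regular_partition_iff)
  have "(\<Sum>P\<in>\<P>. r P * \<mu> (P \<inter> R)) = (\<Sum>P\<in>\<P>. \<Sum>Q\<in>\<Q>. r P * \<mu> (P \<inter> Q \<inter> R))"
  proof (rule sum.cong[OF refl])
    fix P assume "P \<in> \<P>"
    then have "\<mu> (P \<inter> R) = (\<Sum>Q\<in>\<Q>. \<mu> (P \<inter> Q \<inter> R))"
      using content_partition[OF \<mu> Q regular_open_Int[OF regP R], of P]
      by (simp add: Int_ac)
    then show "r P * \<mu> (P \<inter> R) = (\<Sum>Q\<in>\<Q>. r P * \<mu> (P \<inter> Q \<inter> R))"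
      by (simp add: sum_distrib_left)
  qed
  also have "\<dots> \<le> (\<Sum>P\<in>\<P>. \<Sum>Q\<in>\<Q>. s Q * \<mu> (P \<inter> Q \<inter> R))"
  proof (intro sum_mono)
    fix P Q assume PQ: "P \<in> \<P>" "Q \<in> \<Q>"
    show "r P * \<mu> (P \<inter> Q \<inter> R) \<le> s Q * \<mu> (P \<inter> Q \<inter> R)"
    proof (cases "P \<inter> Q \<inter> R = {}")
      case True
      then show ?thesis by (simp add: content_empty[OF \<mu>])
    next
      case False
      then show ?thesis
        using le[OF PQ False] PQ
        by (intro mult_right_mono content_nonneg[OF \<mu>] regular_open_Int regP regQ R)
    qed
  qed
  also have "\<dots> = (\<Sum>Q\<in>\<Q>. \<Sum>P\<in>\<P>. s Q * \<mu> (P \<inter> Q \<inter> R))"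
    by (rule sum.swap)
  also have "\<dots> = (\<Sum>Q\<in>\<Q>. s Q * \<mu> (Q \<inter> R))"
  proof (rule sum.cong[OF refl])
    fix Q assume "Q \<in> \<Q>"
    then have "\<mu> (Q \<inter> R) = (\<Sum>P\<in>\<P>. \<mu> (P \<inter> Q \<inter> R))"
      using content_partition[OF \<mu> P regular_open_Int[OF regQ R], of Q]
      by (simp add: Int_ac)
    then show "(\<Sum>P\<in>\<P>. s Q * \<mu> (P \<inter> Q \<inter> R)) = s Q * \<mu> (Q \<inter> R)"
      by (simp add: sum_distrib_left)
  qed
  finally show ?thesis .
qed

lemma simple_content_integral_eq:
  assumes \<mu>: "regular_content \<mu>" and R: "regular_open R"
    and P: "regular_partition \<P>" and f: "\<And>P x. P \<in> \<P> \<Longrightarrow> x \<in> P \<Longrightarrow> f x = r P"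
  shows "simple_content_integral \<mu> R f = (\<Sum>P\<in>\<P>. r P * \<mu> (P \<inter> R))"
  unfolding simple_content_integral_def
proof (rule the_equality)
  show "\<exists>\<P>' r'. regular_partition \<P>' \<and> (\<forall>P\<in>\<P>'. \<forall>x\<in>P. f x = r' P) \<and>
          (\<Sum>P\<in>\<P>. r P * \<mu> (P \<inter> R)) = (\<Sum>P\<in>\<P>'. r' P * \<mu> (P \<inter> R))"
    using P f by blast
next
  fix I
  assume "\<exists>\<Q> s. regular_partition \<Q> \<and> (\<forall>Q\<in>\<Q>. \<forall>x\<in>Q. f x = s Q) \<and>
            I = (\<Sum>Q\<in>\<Q>. s Q * \<mu> (Q \<inter> R))"
  then obtain \<Q> s where Q: "regular_partition \<Q>" and s: "\<And>Q x. Q \<in> \<Q> \<Longrightarrow> x \<in> Q \<Longrightarrow> f x = s Q"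
    and I: "I = (\<Sum>Q\<in>\<Q>. s Q * \<mu> (Q \<inter> R))"
    by blast
  have eq: "r P = s Q" if "P \<in> \<P>" "Q \<in> \<Q>" "x \<in> P" "x \<in> Q" for P Q x
    using f s that by metis
  show "I = (\<Sum>P\<in>\<P>. r P * \<mu> (P \<inter> R))"
    unfolding I
    by (intro antisym content_sum_le \<mu> R P Q) (use eq in \<open>force+\<close>)
qed

text \<open>Lowering the cell values by \<open>\<epsilon>\<close> gives an admissible simple
  minorant of \<open>g\<close>, and raising them by \<open>\<epsilon>\<close> dominates every
  minorant cell by cell. Each shift costs \<open>\<epsilon> * \<mu> R\<close>, since the traces of
  the cells on \<open>R\<close> add up to \<open>\<mu> R\<close>.\<close>

lemma content_integral_bracket:
  assumes \<mu>: "regular_content \<mu>" and R: "regular_open R" and P: "regular_partition \<P>"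
    and lower: "\<And>x. x \<in> R \<Longrightarrow> M \<le> g x"
    and close: "\<And>P x. P \<in> \<P> \<Longrightarrow> x \<in> P \<Longrightarrow> x \<in> R \<Longrightarrow> \<bar>g x - r P\<bar> \<le> \<epsilon>"
  shows "\<bar>content_integral \<mu> R g - (\<Sum>P\<in>\<P>. r P * \<mu> (P \<inter> R))\<bar> \<le> \<epsilon> * \<mu> R"
proof -
  define S where "S = (\<Sum>P\<in>\<P>. r P * \<mu> (P \<inter> R))"
  have shift: "(\<Sum>P\<in>\<P>. (r P + c) * \<mu> (P \<inter> R)) = S + c * \<mu> R" for c
    using content_partition[OF \<mu> P R]
    by (simp add: S_def distrib_right sum.distrib flip: sum_distrib_left)
  let ?A = "{simple_content_integral \<mu> R f | f.
              bounded (range f) \<and> regular_simple f \<and> (\<forall>x\<in>R. f x \<le> g x)}"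
  have upper: "I \<le> S + \<epsilon> * \<mu> R" if "I \<in> ?A" for I
  proof -
    obtain f where I: "I = simple_content_integral \<mu> R f" and "regular_simple f"
      and le: "\<forall>x\<in>R. f x \<le> g x"
      using \<open>I \<in> ?A\<close> by blast
    then obtain \<Q> where Q: "regular_partition \<Q>" "\<forall>Q\<in>\<Q>. \<exists>c. \<forall>x\<in>Q. f x = c"
      unfolding regular_simple_def constant_on_def by blast
    then obtain s where s: "\<And>Q x. Q \<in> \<Q> \<Longrightarrow> x \<in> Q \<Longrightarrow> f x = s Q"
      by metis
    have "I = (\<Sum>Q\<in>\<Q>. s Q * \<mu> (Q \<inter> R))"
      unfolding I by (rule simple_content_integral_eq[OF \<mu> R Q(1) s])
    also have "\<dots> \<le> (\<Sum>P\<in>\<P>. (r P + \<epsilon>) * \<mu> (P \<inter> R))"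
    proof (rule content_sum_le[OF \<mu> R Q(1) P])
      fix Q P assume *: "Q \<in> \<Q>" "P \<in> \<P>" "Q \<inter> P \<inter> R \<noteq> {}"
      then obtain x where x: "x \<in> Q" "x \<in> P" "x \<in> R" by blast
      show "s Q \<le> r P + \<epsilon>"
        using s[OF *(1) x(1)] bspec[OF le x(3)] close[OF *(2) x(2,3)] by linarith
    qed
    finally show ?thesis by (simp add: shift)
  qed
  define p where "p x = (SOME P. P \<in> \<P> \<and> x \<in> P)" for x
  have p: "p x = P" if "P \<in> \<P>" "x \<in> P" for P x
    unfolding p_def
  proof (rule some_equality)
    show "Q = P" if "Q \<in> \<P> \<and> x \<in> Q" for Q
      using P that \<open>P \<in> \<P>\<close> \<open>x \<in> P\<close> unfolding regular_partition_iff disjoint_def by blast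
  qed (use that in blast)
  \<comment> \<open>A minorant must stay below \<open>g\<close> at every point of \<open>R\<close>,
    including the points in no cell; there \<open>h\<close> takes the lower bound
    \<open>M\<close>.\<close>
  define h where "h x = (if x \<in> \<Union>\<P> then r (p x) + - \<epsilon> else M)" for x
  have h: "h x = r P + - \<epsilon>" if "P \<in> \<P>" "x \<in> P" for P x
    using that p[OF that] by (auto simp: h_def)
  have "range h \<subseteq> insert M ((\<lambda>P. r P + - \<epsilon>) ` \<P>)"
    using h by (auto simp: h_def p)
  then have "bounded (range h)"
    using P by (meson finite.insertI finite_imageI finite_imp_bounded finite_subset regular_partition_iff)
  moreover have "regular_simple h"
    unfolding regular_simple_def constant_on_def using P h by blast
  moreover have "h x \<le> g x" if "x \<in> R" for x
  proof (cases "x \<in> \<Union>\<P>")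
    case True
    then obtain P where "P \<in> \<P>" "x \<in> P" by blast
    then show ?thesis using h[of P x] close[of P x] that by auto
  qed (use lower that in \<open>auto simp: h_def\<close>)
  ultimately have "simple_content_integral \<mu> R h \<in> ?A"
    by blast
  moreover have "simple_content_integral \<mu> R h = S - \<epsilon> * \<mu> R"
    using simple_content_integral_eq[OF \<mu> R P h] shift[of "- \<epsilon>"] by simp
  ultimately have mem: "S - \<epsilon> * \<mu> R \<in> ?A"
    by simp
  have "Sup ?A \<le> S + \<epsilon> * \<mu> R"
    using mem upper by (intro cSup_least) auto
  moreover have "S - \<epsilon> * \<mu> R \<le> Sup ?A"
    using mem upper by (intro cSup_upper bdd_aboveI) auto
  ultimately show ?thesis
    unfolding content_integral_def S_def[symmetric] by linarith
qed

text \<open>The open set \<open>{x. g x < t}\<close> need not be regular, so space is cut along the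
  interior \<open>V\<close> of its closure, which lies between \<open>{x. g x < t}\<close> and
  \<open>{x. g x \<le> t}\<close>. Points with \<open>g x = t\<close> may fall on either side, hence
  the weak inequality in the conclusion.\<close>

lemma level_partition:
  fixes g :: "'a::topological_space \<Rightarrow> real"
  assumes g: "continuous_on UNIV g" and "finite T"
  shows "\<exists>\<P>. regular_partition \<P> \<and>
           (\<forall>P\<in>\<P>. \<forall>t\<in>T. \<forall>x\<in>P. \<forall>y\<in>P. g x < t \<longrightarrow> g y \<le> t)"
  using assms(2)
proof (induction T)
  case empty
  have "regular_partition {UNIV}"
    by (simp add: regular_partition_iff regular_open_UNIV)
  then show ?case by blast
next
  case (insert t T)
  then obtain \<P> where P: "regular_partition \<P>"
    and lev: "\<And>P s x y. P \<in> \<P> \<Longrightarrow> s \<in> T \<Longrightarrow> x \<in> P \<Longrightarrow> y \<in> P \<Longrightarrow> g x < s \<Longrightarrow> g y \<le> s"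
    by blast
  define V where "V = interior (closure {x. g x < t})"
  have V: "regular_open V"
    unfolding V_def by (rule regular_open_interior_closure)
  have "open {x. g x < t}"
    using g by (intro open_Collect_less) (auto intro: continuous_on_const)
  then have sub: "{x. g x < t} \<subseteq> V"
    unfolding V_def by (simp add: closure_subset interior_maximal)
  have "closed {x. g x \<le> t}"
    using g by (intro closed_Collect_le) (auto intro: continuous_on_const)
  then have "closure {x. g x < t} \<subseteq> {x. g x \<le> t}"
    by (intro closure_minimal) auto
  then have sup: "V \<subseteq> {x. g x \<le> t}"
    unfolding V_def using interior_subset by blast
  let ?C = "(\<lambda>(A,B). A \<inter> B) ` (\<P> \<times> {V, - closure V})"
  have "regular_partition ?C"
    by (intro regular_partition_refinement P regular_partition_complement V)
  moreover have "g y \<le> s" if "C \<in> ?C" "s \<in> insert t T" "x \<in> C" "y \<in> C" "g x < s" for C s x y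
  proof (cases "s = t")
    case True
    obtain P Q where C: "C = P \<inter> Q" "Q = V \<or> Q = - closure V"
      using \<open>C \<in> ?C\<close> by blast
    have "x \<in> V"
      using that True sub by auto
    then have "x \<notin> - closure V"
      using closure_subset by auto
    then have "Q = V"
      using C that by auto
    then show ?thesis
      using C that True sup by auto
  next
    case False
    then show ?thesis
      using that lev[of _ s x y] by auto
  qed
  ultimately show ?case by blast
qed

definition fine_on :: "('a \<Rightarrow> real) \<Rightarrow> real \<Rightarrow> 'a set set \<Rightarrow> bool" where
  "fine_on g \<epsilon> \<P> \<longleftrightarrow> (\<forall>P\<in>\<P>. \<forall>x\<in>P. \<forall>y\<in>P. \<bar>g x - g y\<bar> \<le> \<epsilon>)"

lemma fine_partition:
  fixes g :: "'a::topological_space \<Rightarrow> real"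
  assumes g: "continuous_on UNIV g" "bounded (range g)" and "\<epsilon> > 0"
  shows "\<exists>\<P>. regular_partition \<P> \<and> (fine_on g \<epsilon> \<P>)"
proof -
  obtain M where M: "\<And>x. \<bar>g x\<bar> \<le> M"
    using g(2) by (auto simp: bounded_iff)
  \<comment> \<open>With \<open>\<bar>g x / \<epsilon>\<bar> \<le> M / \<epsilon>\<close>, the index
    \<open>k\<close> chosen below is at most the ceiling of \<open>M / \<epsilon>\<close> plus 1;
    adding 2 leaves room on both sides.\<close>
  define N where "N = \<lceil>M / \<epsilon>\<rceil> + 2"
  define T where "T = (\<lambda>k::int. \<epsilon> * k) ` {-N..N}"
  obtain \<P> where P: "regular_partition \<P>"
    and lev: "\<And>P s x y. P \<in> \<P> \<Longrightarrow> s \<in> T \<Longrightarrow> x \<in> P \<Longrightarrow> y \<in> P \<Longrightarrow> g x < s \<Longrightarrow> g y \<le> s"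
    using level_partition[OF g(1), of T] by (auto simp: T_def)
  have "g y - g x \<le> \<epsilon>" if "P \<in> \<P>" "x \<in> P" "y \<in> P" for P x y
  proof -
    \<comment> \<open>\<open>\<epsilon> * k\<close> is the first multiple of
      \<open>\<epsilon>\<close> strictly above \<open>g x\<close>. It is one of the levels, so it
      bounds \<open>g\<close> on the whole cell and exceeds \<open>g x\<close> by at most
      \<open>\<epsilon>\<close>.\<close>
    define k where "k = \<lfloor>g x / \<epsilon>\<rfloor> + 1"
    have "k > g x / \<epsilon>" "k \<le> g x / \<epsilon> + 1"
      unfolding k_def by linarith+
    then have k: "g x < \<epsilon> * k" "\<epsilon> * k \<le> g x + \<epsilon>"
      using \<open>\<epsilon> > 0\<close> by (simp_all add: field_simps)
    have "\<bar>g x / \<epsilon>\<bar> \<le> M / \<epsilon>"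
      using M[of x] \<open>\<epsilon> > 0\<close> by (simp add: divide_right_mono)
    then have "k \<in> {-N..N}"
      unfolding k_def N_def by (auto; linarith)
    then have "\<epsilon> * k \<in> T"
      by (auto simp: T_def)
    then have "g y \<le> \<epsilon> * k"
      using lev that k by blast
    then show ?thesis using k by linarith
  qed
  then have "fine_on g \<epsilon> \<P>"
    by (simp add: fine_on_def abs_le_iff)
  with P show ?thesis by blast
qed

lemma fine_partition_pair:
  fixes f g :: "'a::topological_space \<Rightarrow> real"
  assumes "continuous_on UNIV f" "bounded (range f)" "continuous_on UNIV g" "bounded (range g)" "\<epsilon> > 0"
  obtains \<P> where "regular_partition \<P>" "fine_on f \<epsilon> \<P>"
    "fine_on g \<epsilon> \<P>"
proof -
  obtain \<P> where P: "regular_partition \<P>" "fine_on f \<epsilon> \<P>"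
    using fine_partition[OF assms(1,2,5)] by blast
  obtain \<Q> where Q: "regular_partition \<Q>" "fine_on g \<epsilon> \<Q>"
    using fine_partition[OF assms(3,4,5)] by blast
  show thesis
    by (rule that[OF regular_partition_refinement[OF P(1) Q(1)]]) (use P(2) Q(2) in \<open>auto simp: fine_on_def\<close>)
qed

text \<open>At an empty cell the sample point is arbitrary, but the content of that cell is \<open>0\<close>.\<close>

definition riemann_sum :: "('a set \<Rightarrow> real) \<Rightarrow> 'a set \<Rightarrow> 'a set set \<Rightarrow> ('a \<Rightarrow> real) \<Rightarrow> real" where
  "riemann_sum \<mu> R \<P> g = (\<Sum>P\<in>\<P>. g (SOME x. x \<in> P) * \<mu> (P \<inter> R))"

lemma riemann_sum_add: "riemann_sum \<mu> R \<P> (\<lambda>x. f x + g x) = riemann_sum \<mu> R \<P> f + riemann_sum \<mu> R \<P> g"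
  and riemann_sum_cmult: "riemann_sum \<mu> R \<P> (\<lambda>x. c * f x) = c * riemann_sum \<mu> R \<P> f"
  by (simp_all add: riemann_sum_def distrib_right sum.distrib sum_distrib_left mult.assoc)

lemma riemann_sum_mono:
  assumes "regular_content \<mu>" "regular_open R" "regular_partition \<P>" "\<forall>x. f x \<le> g x"
  shows "riemann_sum \<mu> R \<P> f \<le> riemann_sum \<mu> R \<P> g"
  unfolding riemann_sum_def using assms
  by (intro sum_mono mult_right_mono content_nonneg regular_open_Int)
     (auto simp: regular_partition_iff)

text \<open>A supremum over minorants is only superadditive at first sight, whereas Riemann sums
  over a fixed partition are exactly linear. The properties of the integral below are therefore
  proved for sums over one fine partition, and the error, a constant times
  \<open>\<epsilon>\<close>, is removed by \<open>eq_of_close\<close> or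
  \<open>le_of_close\<close>.\<close>

lemma riemann_sum_close:
  assumes \<mu>: "regular_content \<mu>" and R: "regular_open R" and P: "regular_partition \<P>"
    and bdd: "bounded (range g)"
    and fine: "fine_on g \<epsilon> \<P>"
  shows "\<bar>content_integral \<mu> R g - riemann_sum \<mu> R \<P> g\<bar> \<le> \<epsilon> * \<mu> R"
proof -
  obtain M where "\<And>x. \<bar>g x\<bar> \<le> M"
    using bdd by (auto simp: bounded_iff)
  then have M: "- M \<le> g x" for x
    by (simp add: abs_le_iff minus_le_iff)
  have pick: "(SOME x. x \<in> P) \<in> P" if "x \<in> P" for P and x :: 'a
    using that by (rule someI)
  show ?thesis
    unfolding riemann_sum_def
    by (rule content_integral_bracket[OF \<mu> R P, where M = "- M"])
       (use M fine pick in \<open>auto simp: fine_on_def\<close>)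
qed

lemma eq_of_close:
  fixes a b C :: real
  assumes "\<And>\<epsilon>. \<epsilon> > 0 \<Longrightarrow> \<bar>a - b\<bar> \<le> \<epsilon> * C"
  shows "a = b"
proof (rule ccontr)
  assume "a \<noteq> b"
  then have "\<bar>a - b\<bar> / (2 * (\<bar>C\<bar> + 1)) > 0"
    by simp
  note assms[OF this]
  also have "\<bar>a - b\<bar> / (2 * (\<bar>C\<bar> + 1)) * C \<le> \<bar>a - b\<bar> / (2 * (\<bar>C\<bar> + 1)) * (\<bar>C\<bar> + 1)"
    by (intro mult_left_mono) auto
  also have "\<dots> = \<bar>a - b\<bar> / 2"
    by (simp add: field_simps)
  finally show False
    using \<open>a \<noteq> b\<close> by simp
qed

lemma le_of_close:
  fixes a b C :: real
  assumes "\<And>\<epsilon>. \<epsilon> > 0 \<Longrightarrow> a \<le> b + \<epsilon> * C"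
  shows "a \<le> b"
proof (rule ccontr)
  assume "\<not> a \<le> b"
  have "\<bar>max a b - b\<bar> \<le> \<epsilon> * \<bar>C\<bar>" if "\<epsilon> > 0" for \<epsilon>
  proof -
    have "\<epsilon> * C \<le> \<epsilon> * \<bar>C\<bar>" "0 \<le> \<epsilon> * \<bar>C\<bar>"
      using that by (auto intro: mult_left_mono)
    then show ?thesis
      using assms[OF that] by linarith
  qed
  from eq_of_close[OF this] \<open>\<not> a \<le> b\<close> show False
    by simp
qed

section \<open>Linearity, monotonicity and dependence on the domain\<close>

lemma content_integral_add:
  assumes \<mu>: "regular_content \<mu>" and R: "regular_open R"
    and f: "continuous_on UNIV f" "bounded (range f)"
    and g: "continuous_on UNIV g" "bounded (range g)"
  shows "content_integral \<mu> R (\<lambda>x. f x + g x) = content_integral \<mu> R f + content_integral \<mu> R g"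
proof (rule eq_of_close)
  fix \<epsilon> :: real assume "\<epsilon> > 0"
  then obtain \<P> where P: "regular_partition \<P>"
    and fineF: "fine_on f \<epsilon> \<P>"
    and fineG: "fine_on g \<epsilon> \<P>"
    using fine_partition_pair[OF f g] by blast
  have fine: "fine_on (\<lambda>x. f x + g x) (2 * \<epsilon>) \<P>"
    using fineF fineG unfolding fine_on_def by (smt (verit))
  have bdd: "bounded (range (\<lambda>x. f x + g x))"
    using bounded_plus_comp[OF f(2) g(2)] .
  show "\<bar>content_integral \<mu> R (\<lambda>x. f x + g x) - (content_integral \<mu> R f + content_integral \<mu> R g)\<bar>
          \<le> \<epsilon> * (4 * \<mu> R)"
    using riemann_sum_close[OF \<mu> R P bdd fine] riemann_sum_close[OF \<mu> R P f(2) fineF]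
      riemann_sum_close[OF \<mu> R P g(2) fineG]
    unfolding riemann_sum_add by (simp add: abs_le_iff)
qed

lemma content_integral_cmult:
  assumes \<mu>: "regular_content \<mu>" and R: "regular_open R"
    and f: "continuous_on UNIV f" "bounded (range f)"
  shows "content_integral \<mu> R (\<lambda>x. c * f x) = c * content_integral \<mu> R f"
proof (rule eq_of_close)
  fix \<epsilon> :: real assume "\<epsilon> > 0"
  then obtain \<P> where P: "regular_partition \<P>"
    and fine: "fine_on f \<epsilon> \<P>"
    using fine_partition[OF f] by metis
  have fine': "fine_on (\<lambda>x. c * f x) (\<bar>c\<bar> * \<epsilon>) \<P>"
    using fine by (auto simp: fine_on_def abs_mult mult_left_mono simp flip: right_diff_distrib)
  have bdd: "bounded (range (\<lambda>x. c * f x))"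
    using bounded_scaling[OF f(2), of c] by (simp add: image_image)
  have "\<bar>c * content_integral \<mu> R f - c * riemann_sum \<mu> R \<P> f\<bar> \<le> \<bar>c\<bar> * (\<epsilon> * \<mu> R)"
    using mult_left_mono[OF riemann_sum_close[OF \<mu> R P f(2) fine], of "\<bar>c\<bar>"]
    by (simp flip: right_diff_distrib abs_mult)
  with riemann_sum_close[OF \<mu> R P bdd fine']
  show "\<bar>content_integral \<mu> R (\<lambda>x. c * f x) - c * content_integral \<mu> R f\<bar> \<le> \<epsilon> * (2 * \<bar>c\<bar> * \<mu> R)"
    unfolding riemann_sum_cmult by (simp add: abs_le_iff algebra_simps)
qed

lemma content_integral_mono:
  assumes \<mu>: "regular_content \<mu>" and R: "regular_open R"
    and f: "continuous_on UNIV f" "bounded (range f)"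
    and g: "continuous_on UNIV g" "bounded (range g)" and le: "\<forall>x. f x \<le> g x"
  shows "content_integral \<mu> R f \<le> content_integral \<mu> R g"
proof (rule le_of_close)
  fix \<epsilon> :: real assume "\<epsilon> > 0"
  then obtain \<P> where P: "regular_partition \<P>"
    and fineF: "fine_on f \<epsilon> \<P>"
    and fineG: "fine_on g \<epsilon> \<P>"
    using fine_partition_pair[OF f g] by blast
  show "content_integral \<mu> R f \<le> content_integral \<mu> R g + \<epsilon> * (2 * \<mu> R)"
    using riemann_sum_mono[OF \<mu> R P le] riemann_sum_close[OF \<mu> R P f(2) fineF]
      riemann_sum_close[OF \<mu> R P g(2) fineG]
    by (simp add: abs_le_iff)
qed

lemma content_integral_const:
  assumes \<mu>: "regular_content \<mu>" and R: "regular_open R"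
  shows "content_integral \<mu> R (\<lambda>_. c) = c * \<mu> R"
proof -
  have "regular_partition {UNIV :: 'a set}"
    by (simp add: regular_partition_iff regular_open_UNIV)
  then show ?thesis
    using content_integral_bracket[OF \<mu> R, of "{UNIV}" c "\<lambda>_. c" "\<lambda>_. c" 0] by simp
qed

lemma content_integral_eq_0:
  assumes "regular_content \<mu>" "regular_open R" "\<And>x. x \<in> R \<Longrightarrow> f x = 0"
  shows "content_integral \<mu> R f = 0"
  using content_integral_cong[of R f "\<lambda>_. 0" \<mu>] content_integral_const[OF assms(1,2), of 0] assms(3)
  by simp

lemma content_integral_nonneg:
  assumes \<mu>: "regular_content \<mu>" and R: "regular_open R"
    and f: "continuous_on UNIV f" "bounded (range f)" "\<And>x. 0 \<le> f x"
  shows "0 \<le> content_integral \<mu> R f"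
  using content_integral_mono[OF \<mu> R _ _ f(1,2), of "\<lambda>_. 0"] f(3) content_integral_const[OF \<mu> R, of 0]
  by (simp add: image_constant_conv)

text \<open>Over any partition the two integrals have literally the same Riemann sums. This turns
  integration over a cell into integration of a different content over the whole space, where the
  representation theorem applies.\<close>

lemma content_integral_restrict:
  assumes \<mu>: "regular_content \<mu>" and R: "regular_open R"
    and f: "continuous_on UNIV f" "bounded (range f)"
  shows "content_integral (\<lambda>Q. \<mu> (Q \<inter> R)) UNIV f = content_integral \<mu> R f"
proof (rule eq_of_close)
  fix \<epsilon> :: real assume "\<epsilon> > 0"
  then obtain \<P> where P: "regular_partition \<P>"
    and fine: "fine_on f \<epsilon> \<P>"
    using fine_partition[OF f] by metis
  show "\<bar>content_integral (\<lambda>Q. \<mu> (Q \<inter> R)) UNIV f - content_integral \<mu> R f\<bar> \<le> \<epsilon> * (2 * \<mu> R)"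
    using riemann_sum_close[OF \<mu> R P f(2) fine]
      riemann_sum_close[OF regular_content_restrict[OF \<mu> R] regular_open_UNIV P f(2) fine]
    by (simp add: abs_le_iff riemann_sum_def)
qed

lemma content_integral_partition:
  assumes \<mu>: "regular_content \<mu>" and Q: "regular_partition \<Q>"
    and f: "continuous_on UNIV f" "bounded (range f)"
  shows "(\<Sum>Q\<in>\<Q>. content_integral \<mu> Q f) = content_integral \<mu> UNIV f"
proof (rule eq_of_close)
  fix \<epsilon> :: real assume "\<epsilon> > 0"
  then obtain \<P> where P: "regular_partition \<P>"
    and fine: "fine_on f \<epsilon> \<P>"
    using fine_partition[OF f] by metis
  have reg: "regular_open R" if "R \<in> \<P> \<union> \<Q>" for R
    using P Q that by (auto simp: regular_partition_iff)
  \<comment> \<open>After exchanging the sums, the inner one is the content of \<open>P\<close> cut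
    along \<open>\<Q>\<close>, which \<open>content_partition\<close> evaluates to the content of
    \<open>P\<close>.\<close>
  have "(\<Sum>Q\<in>\<Q>. riemann_sum \<mu> Q \<P> f) = (\<Sum>P\<in>\<P>. f (SOME x. x \<in> P) * (\<Sum>Q\<in>\<Q>. \<mu> (Q \<inter> P)))"
    unfolding riemann_sum_def by (subst sum.swap) (simp add: sum_distrib_left Int_commute)
  also have "\<dots> = riemann_sum \<mu> UNIV \<P> f"
    unfolding riemann_sum_def using content_partition[OF \<mu> Q] reg by simp
  finally have *: "(\<Sum>Q\<in>\<Q>. riemann_sum \<mu> Q \<P> f) = riemann_sum \<mu> UNIV \<P> f" .
  have "\<bar>(\<Sum>Q\<in>\<Q>. content_integral \<mu> Q f) - (\<Sum>Q\<in>\<Q>. riemann_sum \<mu> Q \<P> f)\<bar>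
          \<le> (\<Sum>Q\<in>\<Q>. \<bar>content_integral \<mu> Q f - riemann_sum \<mu> Q \<P> f\<bar>)"
    unfolding sum_subtractf[symmetric] by (rule sum_abs)
  also have "\<dots> \<le> (\<Sum>Q\<in>\<Q>. \<epsilon> * \<mu> Q)"
    by (intro sum_mono riemann_sum_close[OF \<mu> _ P f(2) fine]) (use reg in auto)
  also have "\<dots> = \<epsilon> * \<mu> UNIV"
    using content_partition[OF \<mu> Q regular_open_UNIV] by (simp flip: sum_distrib_left)
  finally show "\<bar>(\<Sum>Q\<in>\<Q>. content_integral \<mu> Q f) - content_integral \<mu> UNIV f\<bar> \<le> \<epsilon> * (2 * \<mu> UNIV)"
    using riemann_sum_close[OF \<mu> regular_open_UNIV P f(2) fine]
    unfolding * by (simp add: abs_le_iff)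
qed

lemma content_integral_complement:
  assumes \<mu>: "regular_content \<mu>" and R: "regular_open R"
    and f: "continuous_on UNIV f" "bounded (range f)"
  shows "content_integral \<mu> UNIV f = content_integral \<mu> R f + content_integral \<mu> (- closure R) f"
  unfolding content_integral_partition[OF \<mu> regular_partition_complement[OF R] f, symmetric]
  by (subst sum.insert) (use neq_Compl_closure[of R] in auto)

section \<open>The Radon measure of a content\<close>

lemma normal_shrink:
  fixes S :: "'a::t4_space set"
  assumes "closed S" "open U" "S \<subseteq> U"
  obtains W where "open W" "S \<subseteq> W" "closure W \<subseteq> U"
proof -
  obtain V W where VW: "open V" "open W" "S \<subseteq> W" "- U \<subseteq> V" "W \<inter> V = {}"
    using t4_space[of S "- U"] assms by (metis Compl_disjoint closed_Compl disjoint_eq_subset_Compl double_complement)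
  have "closure W \<subseteq> - V"
    using VW by (intro closure_minimal) auto
  with VW show thesis
    by (intro that[of W]) auto
qed

lemma compact_closure_subset:
  "A \<subseteq> B \<Longrightarrow> compact (closure B) \<Longrightarrow> compact (closure A)"
  by (metis closed_closure closure_mono compact_Int_closed inf.absorb2)

text \<open>Asking for \<open>closure R \<subseteq> U\<close>, and not just
  \<open>R \<subseteq> U\<close>, keeps content concentrated at the frontier of \<open>U\<close>
  from being counted in \<open>U\<close>. Compactness discards content at infinity and later
  provides finite subcovers.\<close>

definition inner_cells :: "'a::topological_space set \<Rightarrow> 'a set set" where
  "inner_cells U = {R. precompact_regular_open R \<and> closure R \<subseteq> U}"

definition inner_content :: "('a::topological_space set \<Rightarrow> real) \<Rightarrow> 'a set \<Rightarrow> ennreal" where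
  "inner_content m U = (SUP R\<in>inner_cells U. ennreal (m R))"

lemma empty_inner_cells: "{} \<in> inner_cells U"
  by (simp add: inner_cells_def precompact_regular_open_def regular_open_empty)

lemma inner_content_mono: "U \<subseteq> V \<Longrightarrow> inner_content m U \<le> inner_content m V"
  unfolding inner_content_def by (rule SUP_subset_mono) (auto simp: inner_cells_def)

lemma inner_content_upper: "R \<in> inner_cells U \<Longrightarrow> ennreal (m R) \<le> inner_content m U"
  unfolding inner_content_def by (rule SUP_upper)

lemma inner_content_empty:
  assumes "regular_content m"
  shows "inner_content m {} = 0"
proof -
  have "inner_cells ({} :: 'a set) = {{}}"
    using empty_inner_cells[of "{}"] by (auto simp: inner_cells_def)
  then show ?thesis
    using content_empty[OF assms] by (simp add: inner_content_def)
qed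

lemma inner_content_le:
  assumes m: "regular_content m" and R: "regular_open R" and "U \<subseteq> R"
  shows "inner_content m U \<le> ennreal (m R)"
  unfolding inner_content_def
proof (rule SUP_least)
  fix Q assume "Q \<in> inner_cells U"
  then have "regular_open Q" "Q \<subseteq> R"
    using assms(3) closure_subset[of Q]
    by (auto simp: inner_cells_def precompact_regular_open_def)
  then show "ennreal (m Q) \<le> ennreal (m R)"
    using content_mono[OF m _ R] by (intro ennreal_leI) auto
qed

text \<open>The join of a cell in \<open>U\<close> and a cell in \<open>V\<close> is a cell in the
  union, and its content is the sum. The lemma is stated for arbitrary disjoint sets because it is
  later applied to the closed set \<open>closure R\<close> and its complement in an open
  set.\<close>

lemma inner_content_disjoint:
  assumes m: "regular_content m" and UV: "U \<inter> V = {}"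
  shows "inner_content m U + inner_content m V \<le> inner_content m (U \<union> V)"
proof -
  have cells: "ennreal (m R) + ennreal (m Q) \<le> inner_content m (U \<union> V)"
    if R: "R \<in> inner_cells U" and Q: "Q \<in> inner_cells V" for R Q
  proof -
    have reg: "regular_open R" "regular_open Q"
      using R Q by (auto simp: inner_cells_def precompact_regular_open_def)
    have disj: "R \<inter> Q = {}"
      using R Q UV closure_subset[of R] closure_subset[of Q] unfolding inner_cells_def by blast
    define J where "J = interior (closure (R \<union> Q))"
    have J: "regular_open J"
      unfolding J_def by (rule regular_open_interior_closure)
    have "closure J \<subseteq> closure R \<union> closure Q"
      unfolding J_def closure_Un by (intro closure_minimal interior_subset) auto
    moreover have "compact (closure R \<union> closure Q)"
      using R Q by (intro compact_Un) (auto simp: inner_cells_def precompact_regular_open_def)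
    ultimately have "compact (closure J)"
      by (metis closed_closure compact_Int_closed inf.absorb2)
    with J \<open>closure J \<subseteq> closure R \<union> closure Q\<close> have "J \<in> inner_cells (U \<union> V)"
      using R Q by (auto simp: inner_cells_def precompact_regular_open_def)
    moreover have "m J = m R + m Q"
    proof -
      have "R \<union> Q \<subseteq> J"
        unfolding J_def using reg
        by (intro interior_maximal closure_subset) (auto simp: regular_open_imp_open)
      then have "R \<inter> J = R" "Q \<subseteq> - closure R \<inter> J"
        using disj reg open_Int_closure_eq_empty[of Q R] by (auto simp: regular_open_imp_open)
      \<comment> \<open>Away from \<open>closure R\<close> the open set \<open>J\<close> lies in
        \<open>closure Q\<close>, hence in the interior of \<open>closure Q\<close>, which is
        \<open>Q\<close> by regularity.\<close>
      moreover have "- closure R \<inter> J \<subseteq> Q"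
      proof -
        have "- closure R \<inter> J \<subseteq> closure Q"
          unfolding J_def closure_Un using interior_subset by blast
        moreover have "open (- closure R \<inter> J)"
          using J by (intro open_Int open_Compl closed_closure regular_open_imp_open)
        ultimately show ?thesis
          using reg(2) interior_maximal unfolding regular_open_def by blast
      qed
      ultimately have "- closure R \<inter> J = Q"
        by blast
      with \<open>R \<inter> J = R\<close> show ?thesis
        using content_split[OF m reg(1) J] by simp
    qed
    ultimately show ?thesis
      using inner_content_upper[of J "U \<union> V" m] content_nonneg[OF m] reg by simp
  qed
  have ne: "inner_cells U \<noteq> {}" "inner_cells V \<noteq> {}"
    using empty_inner_cells by blast+
  have "ennreal (m R) + inner_content m V \<le> inner_content m (U \<union> V)" if "R \<in> inner_cells U" for R
    unfolding inner_content_def[of m V] ennreal_SUP_add_right[OF ne(2)]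
    by (intro SUP_least cells that)
  then show ?thesis
    unfolding inner_content_def[of m U] ennreal_SUP_add_left[OF ne(1), symmetric]
    by (rule SUP_least)
qed

text \<open>A cell inside \<open>U \<union> V\<close> is cut along a neighbourhood of \<open>closure R - V\<close> whose closure
  lies in \<open>U\<close>.\<close>

lemma inner_content_Un:
  fixes U V :: "'a::t4_space set"
  assumes m: "regular_content m" and U: "open U" and V: "open V"
  shows "inner_content m (U \<union> V) \<le> inner_content m U + inner_content m V"
  unfolding inner_content_def[of m "U \<union> V"]
proof (rule SUP_least)
  fix R assume R: "R \<in> inner_cells (U \<union> V)"
  then have regR: "regular_open R" and cpt: "compact (closure R)" and sub: "closure R \<subseteq> U \<union> V"
    by (auto simp: inner_cells_def precompact_regular_open_def)
  obtain W where W: "open W" "closure R - V \<subseteq> W" "closure W \<subseteq> U"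
    using normal_shrink[of "closure R - V" U] U V sub by (auto simp: closed_Diff)
  define Q where "Q = interior (closure W)"
  have Q: "regular_open Q" "W \<subseteq> Q" "closure Q \<subseteq> closure W"
    unfolding Q_def using W(1)
    by (auto simp: regular_open_interior_closure closure_subset interior_maximal
        intro!: closure_minimal interior_subset del: subsetI)
  have "Q \<inter> R \<in> inner_cells U"
    using Q W(3) regR compact_closure_subset[OF _ cpt, of "Q \<inter> R"] closure_mono[of "Q \<inter> R" Q]
    by (auto simp: inner_cells_def precompact_regular_open_def regular_open_Int)
  moreover have "- closure Q \<inter> R \<in> inner_cells V"
  proof -
    have "closure (- closure Q) \<subseteq> - Q"
      using Q(1) closure_subset[of Q] by (intro closure_minimal) (auto simp: regular_open_imp_open)
    then have "closure (- closure Q \<inter> R) \<subseteq> closure R - W"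
      using Q(2) closure_mono[of "- closure Q \<inter> R" R] closure_mono[of "- closure Q \<inter> R" "- closure Q"]
      by blast
    then show ?thesis
      using W(2) regR Q(1) compact_closure_subset[OF _ cpt, of "- closure Q \<inter> R"]
      by (auto simp: inner_cells_def precompact_regular_open_def regular_open_Int regular_open_Compl_closure)
  qed
  ultimately have "ennreal (m (Q \<inter> R)) + ennreal (m (- closure Q \<inter> R)) \<le> inner_content m U + inner_content m V"
    by (intro add_mono inner_content_upper)
  then show "ennreal (m R) \<le> inner_content m U + inner_content m V"
    using content_nonneg[OF m] regular_open_Int[OF Q(1) regR]
      regular_open_Int[OF regular_open_Compl_closure[OF Q(1)] regR]
    unfolding content_split[OF m Q(1) regR] by simp
qed

lemma inner_content_UN_finite:
  fixes U :: "nat \<Rightarrow> 'a::t4_space set"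
  assumes m: "regular_content m" and U: "\<And>i. open (U i)"
  shows "inner_content m (\<Union>i<n. U i) \<le> (\<Sum>i<n. inner_content m (U i))"
proof (induction n)
  case 0
  then show ?case by (simp add: inner_content_empty[OF m])
next
  case (Suc n)
  have "inner_content m (\<Union>i<Suc n. U i) = inner_content m ((\<Union>i<n. U i) \<union> U n)"
    by (simp add: lessThan_Suc Un_commute)
  also have "\<dots> \<le> inner_content m (\<Union>i<n. U i) + inner_content m (U n)"
    using U by (intro inner_content_Un m) auto
  also have "\<dots> \<le> (\<Sum>i<Suc n. inner_content m (U i))"
    using Suc by (simp add: add_right_mono)
  finally show ?case .
qed

text \<open>Although a content is only finitely additive, countable subadditivity holds: the compact
  closure of a cell is already covered by finitely many of the open sets.\<close>

lemma inner_content_UN: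
  fixes U :: "nat \<Rightarrow> 'a::t4_space set"
  assumes m: "regular_content m" and U: "\<And>i. open (U i)"
  shows "inner_content m (\<Union>i. U i) \<le> (\<Sum>i. inner_content m (U i))"
  unfolding inner_content_def[of m "\<Union>i. U i"]
proof (rule SUP_least)
  fix R assume R: "R \<in> inner_cells (\<Union>i. U i)"
  then have "compact (closure R)" "closure R \<subseteq> (\<Union>i. U i)"
    by (auto simp: inner_cells_def precompact_regular_open_def)
  then obtain I where I: "finite I" "closure R \<subseteq> (\<Union>i\<in>I. U i)"
    using compactE_image[of "closure R" UNIV U] U by (metis subset_UNIV)
  then obtain n where "I \<subseteq> {..<n}"
    using finite_nat_iff_bounded by blast
  with I have "closure R \<subseteq> (\<Union>i<n. U i)"
    by blast
  with R have "R \<in> inner_cells (\<Union>i<n. U i)"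
    by (auto simp: inner_cells_def)
  then have "ennreal (m R) \<le> (\<Sum>i<n. inner_content m (U i))"
    by (rule order_trans[OF inner_content_upper inner_content_UN_finite[OF m U]])
  also have "\<dots> \<le> (\<Sum>i. inner_content m (U i))"
    by (rule sum_le_suminf) auto
  finally show "ennreal (m R) \<le> (\<Sum>i. inner_content m (U i))" .
qed

section \<open>Outer content and Caratheodory's extension\<close>

definition outer_content :: "('a::topological_space set \<Rightarrow> real) \<Rightarrow> 'a set \<Rightarrow> ennreal" where
  "outer_content m A = (INF U\<in>{U. A \<subseteq> U \<and> open U}. inner_content m U)"

lemma outer_content_open: "open U \<Longrightarrow> outer_content m U = inner_content m U"
  unfolding outer_content_def
  by (intro antisym INF_greatest INF_lower) (auto intro: inner_content_mono)

lemma outer_content_mono: "A \<subseteq> B \<Longrightarrow> outer_content m A \<le> outer_content m B"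
  unfolding outer_content_def by (rule INF_superset_mono) auto

lemma outer_content_le: "A \<subseteq> U \<Longrightarrow> open U \<Longrightarrow> outer_content m A \<le> inner_content m U"
  unfolding outer_content_def by (rule INF_lower) auto

lemma outer_content_less_top:
  assumes "regular_content m"
  shows "outer_content m A < top"
  using outer_content_le[of A UNIV m] inner_content_le[OF assms regular_open_UNIV, of UNIV]
  by (simp add: ennreal_less_top le_less_trans)

lemma outer_content_approx:
  assumes "regular_content m" "0 < e"
  obtains U where "open U" "A \<subseteq> U" "inner_content m U \<le> outer_content m A + ennreal e"
proof -
  have "outer_content m A < outer_content m A + ennreal e"
    using outer_content_less_top[OF assms(1), of A] assms(2) by auto
  then obtain U where "A \<subseteq> U" "open U" "inner_content m U < outer_content m A + ennreal e"
    unfolding outer_content_def INF_less_iff by blast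
  then show thesis
    by (intro that[of U]) auto
qed

lemma outer_measure_space_outer_content:
  fixes m :: "'a::t4_space set \<Rightarrow> real"
  assumes m: "regular_content m"
  shows "outer_measure_space (Pow UNIV) (outer_content m)"
  unfolding outer_measure_space_def
proof (intro conjI)
  show "positive (Pow UNIV) (outer_content m)"
    by (simp add: positive_def outer_content_open inner_content_empty[OF m])
  show "increasing (Pow UNIV) (outer_content m)"
    by (simp add: increasing_def outer_content_mono)
  show "countably_subadditive (Pow UNIV) (outer_content m)"
    unfolding countably_subadditive_def
  proof (intro allI impI)
    fix A :: "nat \<Rightarrow> 'a set"
    show "outer_content m (\<Union>i. A i) \<le> (\<Sum>i. outer_content m (A i))"
    proof (rule ennreal_le_epsilon)
      fix e :: real assume "0 < e"
      have "\<exists>U. open U \<and> A n \<subseteq> U \<and> inner_content m U \<le> outer_content m (A n) + ennreal (e * (1/2)^Suc n)" for n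
        by (rule outer_content_approx[OF m, of "e * (1/2)^Suc n" "A n"]) (use \<open>0 < e\<close> in \<open>simp, blast\<close>)
      then obtain U where U: "\<And>n. open (U n)" "\<And>n. A n \<subseteq> U n"
        "\<And>n. inner_content m (U n) \<le> outer_content m (A n) + ennreal (e * (1/2)^Suc n)"
        by metis
      have "outer_content m (\<Union>i. A i) \<le> inner_content m (\<Union>i. U i)"
        using U by (intro outer_content_le) auto
      also have "\<dots> \<le> (\<Sum>n. inner_content m (U n))"
        by (rule inner_content_UN[OF m U(1)])
      also have "\<dots> \<le> (\<Sum>n. outer_content m (A n) + ennreal (e * (1/2)^Suc n))"
        using U by (intro suminf_le) auto
      also have "\<dots> = (\<Sum>n. outer_content m (A n)) + (\<Sum>n. ennreal e * ennreal ((1/2) ^ Suc n))"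
        using \<open>0 < e\<close> by (subst suminf_add[symmetric])
          (auto simp del: ennreal_suminf_cmult simp add: ennreal_mult[symmetric])
      also have "\<dots> = (\<Sum>n. outer_content m (A n)) + e"
        unfolding ennreal_suminf_cmult
        by (subst suminf_ennreal_eq[OF zero_le_power power_half_series]) auto
      finally show "outer_content m (\<Union>i. A i) \<le> (\<Sum>n. outer_content m (A n)) + e" .
    qed
  qed
qed

text \<open>For an open test set \<open>U\<close> and a cell \<open>R\<close> of
  \<open>U \<inter> V\<close>, the set \<open>U - closure R\<close> is an open neighbourhood of
  \<open>U - V\<close> disjoint from \<open>closure R\<close>, so superadditivity applies to this
  pair. The supremum over \<open>R\<close> gives the inequality for open sets, the infimum over
  \<open>U\<close> gives it for all sets.\<close>

lemma open_in_lambda_system_outer_content: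
  fixes m :: "'a::t4_space set \<Rightarrow> real"
  assumes m: "regular_content m" and V: "open V"
  shows "V \<in> lambda_system UNIV (Pow UNIV) (outer_content m)"
proof -
  have opens: "outer_content m (U \<inter> V) + outer_content m (U - V) \<le> inner_content m U"
    if U: "open U" for U
  proof -
    have "ennreal (m R) + outer_content m (U - V) \<le> inner_content m U"
      if R: "R \<in> inner_cells (U \<inter> V)" for R
    proof -
      have cl: "closure R \<subseteq> U \<inter> V"
        using R by (simp add: inner_cells_def)
      have "ennreal (m R) + outer_content m (U - V)
              \<le> inner_content m (closure R) + inner_content m (U - closure R)"
        using R U cl
        by (intro add_mono inner_content_upper outer_content_le) (auto simp: inner_cells_def)
      also have "\<dots> \<le> inner_content m (closure R \<union> (U - closure R))"
        by (intro inner_content_disjoint m) auto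
      also have "closure R \<union> (U - closure R) = U"
        using cl by auto
      finally show ?thesis .
    qed
    moreover have "inner_cells (U \<inter> V) \<noteq> {}"
      using empty_inner_cells by blast
    ultimately show ?thesis
      unfolding outer_content_open[OF open_Int[OF U V]] inner_content_def[of m "U \<inter> V"]
      by (subst ennreal_SUP_add_left[symmetric]) (auto intro: SUP_least)
  qed
  have "outer_content m (A \<inter> V) + outer_content m (A - V) \<le> outer_content m A" for A
    unfolding outer_content_def[of m A]
  proof (rule INF_greatest)
    fix U assume "U \<in> {U. A \<subseteq> U \<and> open U}"
    then have U: "open U" "A \<subseteq> U"
      by auto
    have "outer_content m (A \<inter> V) + outer_content m (A - V)
            \<le> outer_content m (U \<inter> V) + outer_content m (U - V)"
      using U by (intro add_mono outer_content_mono) auto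
    with opens[OF U(1)] show "outer_content m (A \<inter> V) + outer_content m (A - V) \<le> inner_content m U"
      by (rule order_trans[rotated])
  qed
  moreover have "outer_content m A \<le> outer_content m (A \<inter> V) + outer_content m (A - V)" for A
  proof -
    interpret P: sigma_algebra UNIV "Pow UNIV :: 'a set set"
      by (rule sigma_algebra_Pow)
    have "subadditive (Pow UNIV) (outer_content m)"
      using outer_measure_space_outer_content[OF m] unfolding outer_measure_space_def
      by (blast intro: P.countably_subadditive_subadditive)
    then have "outer_content m ((A \<inter> V) \<union> (A - V)) \<le> outer_content m (A \<inter> V) + outer_content m (A - V)"
      by (intro subadditiveD[of "Pow UNIV"]) auto
    moreover have "(A \<inter> V) \<union> (A - V) = A"
      by blast
    ultimately show ?thesis by simp
  qed
  ultimately show ?thesis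
    unfolding algebra.lambda_system_eq[OF algebra_Pow] by (auto intro: antisym)
qed

lemma content_measure_exists:
  fixes m :: "'a::t4_space set \<Rightarrow> real"
  assumes m: "regular_content m"
  obtains \<nu> where "sets \<nu> = sets borel" "\<And>B. B \<in> sets borel \<Longrightarrow> emeasure \<nu> B = outer_content m B"
proof -
  let ?L = "lambda_system UNIV (Pow UNIV) (outer_content m)"
  interpret P: sigma_algebra UNIV "Pow UNIV :: 'a set set"
    by (rule sigma_algebra_Pow)
  have L: "measure_space UNIV ?L (outer_content m)"
    by (rule P.caratheodory_lemma[OF outer_measure_space_outer_content[OF m]])
  then interpret L: sigma_algebra UNIV ?L
    by (simp add: measure_space_def)
  have sub: "sets borel \<subseteq> ?L"
    unfolding sets_borel using open_in_lambda_system_outer_content[OF m]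
    by (intro L.sigma_sets_subset) auto
  define \<nu> where "\<nu> = measure_of UNIV (sets borel) (outer_content m)"
  have "sets \<nu> = sets borel"
    unfolding \<nu>_def by (metis sets.sigma_sets_eq sets.space_closed sets_measure_of space_borel)
  moreover have "emeasure \<nu> B = outer_content m B" if "B \<in> sets borel" for B
    unfolding \<nu>_def
  proof (rule emeasure_measure_of_sigma[OF _ _ _ that])
    show "sigma_algebra UNIV (sets (borel :: 'a measure))"
      using sets.sigma_algebra_axioms[of borel] by simp
    show "positive (sets borel) (outer_content m)"
      using L by (simp add: measure_space_def positive_def)
    show "countably_additive (sets borel) (outer_content m)"
      using L sub unfolding measure_space_def countably_additive_def by blast
  qed
  ultimately show thesis
    using that by blast
qed

section \<open>Radon regularity\<close>

text \<open>For a finite measure, approximation from inside suffices: a compact set nearly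
  exhausting \<open>- B\<close> is closed in a Hausdorff space, and its complement is an open set
  only slightly larger than \<open>B\<close>.\<close>

lemma radon_measureI:
  fixes \<nu> :: "'a::t2_space measure"
  assumes fin: "finite_measure \<nu>" and sets: "sets \<nu> = sets borel"
    and inner: "\<And>B e. B \<in> sets borel \<Longrightarrow> 0 < e \<Longrightarrow>
                  \<exists>K. compact K \<and> K \<subseteq> B \<and> measure \<nu> (B - K) < e"
  shows "radon_measure \<nu>"
proof -
  interpret finite_measure \<nu> by (rule fin)
  have meas[measurable, simp]: "A \<in> sets \<nu> \<longleftrightarrow> A \<in> sets borel" for A
    by (simp add: sets)
  have cpt: "K \<in> sets borel" if "compact K" for K :: "'a set"
    using that by (simp add: borel_compact)
  have "emeasure \<nu> B = (SUP K\<in>{K. K \<subseteq> B \<and> compact K}. emeasure \<nu> K)"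
    if B: "B \<in> sets borel" for B
  proof (rule antisym)
    show "emeasure \<nu> B \<le> (SUP K\<in>{K. K \<subseteq> B \<and> compact K}. emeasure \<nu> K)"
    proof (rule ennreal_le_epsilon)
      fix e :: real assume "0 < e"
      then obtain K where K: "compact K" "K \<subseteq> B" "measure \<nu> (B - K) < e"
        using inner[OF B] by blast
      have "emeasure \<nu> B = emeasure \<nu> K + emeasure \<nu> (B - K)"
        using K B cpt by (subst plus_emeasure) (auto simp: Un_absorb1 sets.Diff)
      also have "\<dots> \<le> emeasure \<nu> K + ennreal e"
        using K(3) by (intro add_left_mono) (simp add: emeasure_eq_measure ennreal_leI)
      also have "\<dots> \<le> (SUP K\<in>{K. K \<subseteq> B \<and> compact K}. emeasure \<nu> K) + ennreal e"
        using K by (intro add_right_mono SUP_upper) auto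
      finally show "emeasure \<nu> B \<le> (SUP K\<in>{K. K \<subseteq> B \<and> compact K}. emeasure \<nu> K) + ennreal e" .
    qed
    show "(SUP K\<in>{K. K \<subseteq> B \<and> compact K}. emeasure \<nu> K) \<le> emeasure \<nu> B"
      using B by (intro SUP_least emeasure_mono) auto
  qed
  moreover have "emeasure \<nu> B = (INF U\<in>{U. B \<subseteq> U \<and> open U}. emeasure \<nu> U)"
    if B: "B \<in> sets borel" for B
  proof (rule antisym)
    show "emeasure \<nu> B \<le> (INF U\<in>{U. B \<subseteq> U \<and> open U}. emeasure \<nu> U)"
      by (intro INF_greatest emeasure_mono) auto
    show "(INF U\<in>{U. B \<subseteq> U \<and> open U}. emeasure \<nu> U) \<le> emeasure \<nu> B"
    proof (rule ennreal_le_epsilon)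
      fix e :: real assume "0 < e"
      moreover have "- B \<in> sets borel"
        using B by auto
      ultimately obtain K where K: "compact K" "K \<subseteq> - B" "measure \<nu> (- B - K) < e"
        using inner by blast
      have "(INF U\<in>{U. B \<subseteq> U \<and> open U}. emeasure \<nu> U) \<le> emeasure \<nu> (- K)"
        using K by (intro INF_lower) (auto simp: compact_imp_closed)
      also have "\<dots> = emeasure \<nu> (B \<union> (- B - K))"
        using K(2) by (intro arg_cong[where f = "emeasure \<nu>"]) auto
      also have "\<dots> \<le> emeasure \<nu> B + emeasure \<nu> (- B - K)"
        using B K cpt by (intro emeasure_subadditive) auto
      also have "\<dots> \<le> emeasure \<nu> B + ennreal e"
        using K(3) by (intro add_left_mono) (simp add: emeasure_eq_measure ennreal_leI)
      finally show "(INF U\<in>{U. B \<subseteq> U \<and> open U}. emeasure \<nu> U) \<le> emeasure \<nu> B + ennreal e" .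
    qed
  qed
  ultimately show ?thesis
    unfolding radon_measure_def using sets by blast
qed

lemma radon_measure_inner:
  fixes \<nu> :: "'a::t2_space measure"
  assumes "radon_measure \<nu>" "finite_measure \<nu>" "B \<in> sets borel" "0 < e"
  obtains K where "compact K" "K \<subseteq> B" "measure \<nu> (B - K) < e"
proof -
  interpret finite_measure \<nu> by (rule assms)
  have sets: "sets \<nu> = sets borel"
    using assms by (simp add: radon_measure_def)
  have sup: "emeasure \<nu> B = (SUP K\<in>{K. K \<subseteq> B \<and> compact K}. emeasure \<nu> K)"
    using assms by (simp add: radon_measure_def)
  show thesis
  \<comment> \<open>\<open>ennreal\<close> truncates negative reals to \<open>0\<close>, so
    \<open>measure \<nu> B - e\<close> is a strict lower bound for the supremum only if it is
    nonnegative; otherwise the empty compact set is enough.\<close>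
  proof (cases "measure \<nu> B < e")
    case True
    then show thesis by (intro that[of "{}"]) auto
  next
    case False
    then have "ennreal (measure \<nu> B - e) < emeasure \<nu> B"
      using assms(4) by (simp add: emeasure_eq_measure ennreal_less_iff)
    then obtain K where K: "K \<subseteq> B" "compact K" "ennreal (measure \<nu> B - e) < emeasure \<nu> K"
      unfolding sup less_SUP_iff by blast
    then have "measure \<nu> B - e < measure \<nu> K"
      using False by (simp add: emeasure_eq_measure ennreal_less_iff)
    moreover have "measure \<nu> (B - K) = measure \<nu> B - measure \<nu> K"
      using K assms(3) by (intro finite_measure_Diff) (auto simp: sets borel_compact)
    ultimately show thesis
      using K by (intro that[of K]) auto
  qed
qed

lemma radon_measure_dominated:
  fixes \<nu> \<rho> :: "'a::t2_space measure"
  assumes \<nu>: "radon_measure \<nu>" "finite_measure \<nu>" and \<rho>: "finite_measure \<rho>" "sets \<rho> = sets borel"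
    and le: "\<And>B. B \<in> sets borel \<Longrightarrow> measure \<rho> B \<le> c * measure \<nu> B"
  shows "radon_measure \<rho>"
proof (rule radon_measureI[OF \<rho>])
  fix B :: "'a set" and e :: real
  assume B: "B \<in> sets borel" and "0 < e"
  then have "0 < e / (\<bar>c\<bar> + 1)"
    by simp
  then obtain K where K: "compact K" "K \<subseteq> B" "measure \<nu> (B - K) < e / (\<bar>c\<bar> + 1)"
    by (rule radon_measure_inner[OF \<nu> B])
  have "measure \<rho> (B - K) \<le> c * measure \<nu> (B - K)"
    using B K by (intro le) (auto simp: borel_compact)
  also have "\<dots> \<le> (\<bar>c\<bar> + 1) * measure \<nu> (B - K)"
    by (intro mult_right_mono) auto
  also have "\<dots> < (\<bar>c\<bar> + 1) * (e / (\<bar>c\<bar> + 1))"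
    using K(3) by (intro mult_strict_left_mono) auto
  also have "\<dots> = e"
    by simp
  finally show "\<exists>K. compact K \<and> K \<subseteq> B \<and> measure \<rho> (B - K) < e"
    using K by blast
qed

text \<open>Outer regularity is built into the outer content. Inner regularity of \<open>B\<close>
  comes from a compact \<open>K\<close> carrying almost all of \<open>\<nu>\<close>, from which an
  open set slightly larger than \<open>- B\<close> is removed. The last two conclusions are what the
  comparison of integrals needs.\<close>

lemma content_radon_measure_exists:
  fixes m :: "'a::t4_space set \<Rightarrow> real"
  assumes m: "regular_content m"
  obtains \<nu> where "radon_measure \<nu>" "finite_measure \<nu>"
    "\<And>U. open U \<Longrightarrow> emeasure \<nu> U = inner_content m U"
    "\<And>R. precompact_regular_open R \<Longrightarrow> m R \<le> measure \<nu> (closure R)"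
proof -
  obtain \<nu> where sets: "sets \<nu> = sets borel"
    and em: "\<And>B. B \<in> sets borel \<Longrightarrow> emeasure \<nu> B = outer_content m B"
    using content_measure_exists[OF m] by blast
  have opn: "emeasure \<nu> U = inner_content m U" if "open U" for U
    using that by (simp add: em outer_content_open)
  have "space \<nu> = UNIV"
    using sets_eq_imp_space_eq[OF sets] by simp
  then have fin: "finite_measure \<nu>"
    using outer_content_less_top[OF m, of UNIV] by (intro finite_measureI) (simp add: em)
  then interpret finite_measure \<nu> .
  have outer: "\<exists>U. open U \<and> B \<subseteq> U \<and> measure \<nu> (U - B) \<le> e" if B: "B \<in> sets borel" and "0 < e" for B e
  proof -
    obtain U where U: "open U" "B \<subseteq> U" "inner_content m U \<le> outer_content m B + ennreal e"
      using outer_content_approx[OF m \<open>0 < e\<close>] .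
    then have "ennreal (measure \<nu> U) \<le> ennreal (measure \<nu> B + e)"
      using B \<open>0 < e\<close> by (simp add: opn[symmetric] em[symmetric] emeasure_eq_measure)
    then have "measure \<nu> U \<le> measure \<nu> B + e"
      using \<open>0 < e\<close> by (subst (asm) ennreal_le_iff) (auto intro: add_nonneg_nonneg)
    moreover have "measure \<nu> (U - B) = measure \<nu> U - measure \<nu> B"
      using U B by (intro finite_measure_Diff) (auto simp: sets)
    ultimately show ?thesis
      using U by auto
  qed
  \<comment> \<open>\<open>R\<close> is an inner cell of every open neighbourhood of its own
    closure, so its content bounds the infimum from below.\<close>
  have closure_ge: "m R \<le> measure \<nu> (closure R)" if "precompact_regular_open R" for R
  proof -
    have "ennreal (m R) \<le> outer_content m (closure R)"
      unfolding outer_content_def using that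
      by (intro INF_greatest inner_content_upper) (auto simp: inner_cells_def)
    then show ?thesis
      by (simp add: em[symmetric] emeasure_eq_measure)
  qed
  \<comment> \<open>Tightness is relative to the mass of \<open>\<nu>\<close>, not of
    \<open>m\<close>: as a supremum over cells, \<open>inner_content m UNIV\<close> is nearly
    attained by one cell, and the closure of that cell serves as \<open>K\<close>.\<close>
  have cpt_UNIV: "\<exists>K. compact K \<and> measure \<nu> (- K) < e" if "0 < e" for e
  proof (cases "measure \<nu> UNIV < e")
    case True
    then show ?thesis by (intro exI[of _ "{}"]) simp
  next
    case False
    then have "ennreal (measure \<nu> UNIV - e) < inner_content m UNIV"
      using that by (simp add: opn[symmetric] emeasure_eq_measure ennreal_less_iff)
    then obtain R where R: "R \<in> inner_cells UNIV" "ennreal (measure \<nu> UNIV - e) < ennreal (m R)"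
      unfolding inner_content_def less_SUP_iff by blast
    then have "measure \<nu> UNIV - e < m R"
      using False by (simp add: ennreal_less_iff)
    also have "\<dots> \<le> measure \<nu> (closure R)"
      using R by (intro closure_ge) (simp add: inner_cells_def)
    finally have "measure \<nu> UNIV - e < measure \<nu> (closure R)" .
    moreover have "measure \<nu> (- closure R) = measure \<nu> UNIV - measure \<nu> (closure R)"
      using finite_measure_compl[of "closure R"] \<open>space \<nu> = UNIV\<close> by (simp add: sets Compl_eq_Diff_UNIV)
    ultimately show ?thesis
      using R by (intro exI[of _ "closure R"]) (auto simp: inner_cells_def precompact_regular_open_def)
  qed
  have "radon_measure \<nu>"
  proof (rule radon_measureI[OF fin sets])
    fix B :: "'a set" and e :: real
    assume B: "B \<in> sets borel" and "0 < e"
    obtain K where K: "compact K" "measure \<nu> (- K) < e / 2"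
      using cpt_UNIV[of "e / 2"] \<open>0 < e\<close> by auto
    have "- B \<in> sets borel"
      using B by auto
    then obtain U where U: "open U" "- B \<subseteq> U" "measure \<nu> (U - - B) \<le> e / 2"
      using outer[of "- B" "e / 2"] \<open>0 < e\<close> by auto
    have "- K \<in> sets borel"
      using K by (intro borel_open) (simp add: compact_imp_closed open_Compl)
    moreover have "U - - B \<in> sets borel"
      using U B by simp
    ultimately have meas: "- K \<in> sets \<nu>" "U - - B \<in> sets \<nu>"
      by (simp_all add: sets)
    have "measure \<nu> (B - K \<inter> - U) \<le> measure \<nu> (- K \<union> (U - - B))"
      using meas by (intro finite_measure_mono sets.Un) auto
    also have "\<dots> \<le> measure \<nu> (- K) + measure \<nu> (U - - B)"
      using meas by (rule measure_Un_le)
    also have "\<dots> < e"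
      using K U by linarith
    finally have "measure \<nu> (B - K \<inter> - U) < e" .
    moreover have "compact (K \<inter> - U)"
      using K U by (intro compact_Int_closed) auto
    moreover have "K \<inter> - U \<subseteq> B"
      using U by auto
    ultimately show "\<exists>K. compact K \<and> K \<subseteq> B \<and> measure \<nu> (B - K) < e"
      by blast
  qed
  with fin opn closure_ge show thesis
    using that by blast
qed

section \<open>Functions vanishing at infinity\<close>

lemma C0_continuous: "f \<in> C0_space \<Longrightarrow> continuous_on UNIV f"
  and C0_bounded: "f \<in> C0_space \<Longrightarrow> bounded (range f)"
  by (simp_all add: C0_space_def)

lemma bounded_range_dominated:
  fixes f g :: "'a \<Rightarrow> real"
  assumes "bounded (range f)" "\<And>x. \<bar>g x\<bar> \<le> \<bar>f x\<bar>"
  shows "bounded (range g)"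
proof -
  obtain M where "\<And>x. \<bar>f x\<bar> \<le> M"
    using assms(1) by (auto simp: bounded_iff)
  then show ?thesis
    using assms(2) order_trans by (intro boundedI[of _ M]) (auto, blast)
qed

lemma C0_dominated:
  assumes f: "f \<in> C0_space" and g: "continuous_on UNIV g" and le: "\<And>x. \<bar>g x\<bar> \<le> \<bar>f x\<bar>"
  shows "g \<in> C0_space"
proof -
  have "bounded (range g)"
    using bounded_range_dominated[OF C0_bounded[OF f] le] .
  moreover have "\<exists>K. compact K \<and> (\<forall>x. x \<notin> K \<longrightarrow> \<bar>g x\<bar> \<le> \<epsilon>)" if e: "0 < \<epsilon>" for \<epsilon>
  proof -
    obtain K where "compact K" "\<forall>x. x \<notin> K \<longrightarrow> \<bar>f x\<bar> \<le> \<epsilon>"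
      using f e unfolding C0_space_def by blast
    then show ?thesis
      using le order_trans by blast
  qed
  ultimately show ?thesis
    using g by (simp add: C0_space_def)
qed

lemma C0_compact_level:
  fixes f :: "'a::topological_space \<Rightarrow> real"
  assumes f: "f \<in> C0_space" and "0 < t"
  shows "compact {x. t \<le> f x}"
proof -
  obtain K where K: "compact K" "\<And>x. x \<notin> K \<Longrightarrow> \<bar>f x\<bar> \<le> t / 2"
  proof -
    have "\<forall>\<epsilon>>0. \<exists>K. compact K \<and> (\<forall>x. x \<notin> K \<longrightarrow> \<bar>f x\<bar> \<le> \<epsilon>)"
      using f by (simp add: C0_space_def)
    then show thesis
      using \<open>0 < t\<close> that half_gt_zero by blast
  qed
  have "{x. t \<le> f x} \<subseteq> K"
  proof
    fix x assume "x \<in> {x. t \<le> f x}"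
    then show "x \<in> K"
      using K(2)[of x] \<open>0 < t\<close> by (cases "x \<in> K") auto
  qed
  moreover have "closed {x. t \<le> f x}"
    by (intro closed_Collect_le continuous_on_const C0_continuous[OF f])
  ultimately show ?thesis
    using K(1) by (metis compact_Int_closed inf.absorb2)
qed

text \<open>Urysohn's function is taken for the smaller neighbourhood \<open>U \<inter> V\<close>,
  where the open set \<open>V\<close> around \<open>K\<close> lies in a compact set
  \<open>L\<close>. It therefore vanishes off \<open>L\<close>, which makes it vanish at
  infinity.\<close>

lemma C0_bump:
  fixes K U :: "'a::t4_space set"
  assumes lc: "locally_compact_space (euclidean :: 'a topology)"
    and K: "compact K" and U: "open U" "K \<subseteq> U"
  obtains h :: "'a \<Rightarrow> real" where "h \<in> C0_space" "\<And>x. 0 \<le> h x" "\<And>x. h x \<le> 1"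
    "\<And>x. x \<in> K \<Longrightarrow> h x = 1" "\<And>x. x \<notin> U \<Longrightarrow> h x = 0"
proof -
  have "Hausdorff_space (euclidean :: 'a topology)"
    unfolding Hausdorff_space_def disjnt_def using hausdorff by auto
  then obtain V L where V: "open V" "compact L" "K \<subseteq> V" "V \<subseteq> L"
    using lc K locally_compact_space_compact_closed_compact[of "euclidean :: 'a topology"]
    by auto
  have "normal_space (euclidean :: 'a topology)"
    unfolding normal_space_def disjnt_def using t4_space by auto
  moreover have "disjnt (- (U \<inter> V)) K"
    using U V by (auto simp: disjnt_def)
  ultimately obtain h where h: "continuous_map euclidean (top_of_set {0..1::real}) h"
    "h ` (- (U \<inter> V)) \<subseteq> {0}" "h ` K \<subseteq> {1}"
    using Urysohn_lemma[of "euclidean :: 'a topology" "- (U \<inter> V)" K 0 1] U V K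
    by (auto simp: compact_imp_closed)
  then have cont: "continuous_on UNIV h" and rng: "\<And>x. h x \<in> {0..1}"
    by (auto simp: continuous_map_in_subtopology)
  have off: "h x = 0" if "x \<notin> U \<or> x \<notin> V" for x
    using h(2) that by auto
  have "bounded (range h)"
    using rng by (intro boundedI[of _ 1]) auto
  moreover have "\<bar>h x\<bar> \<le> e" if "x \<notin> L" "0 < e" for x e
  proof -
    have "h x = 0"
      using off V that by blast
    then show ?thesis
      using that by simp
  qed
  ultimately have "h \<in> C0_space"
    unfolding C0_space_def using cont V(2) by blast
  then show thesis
    using rng off h(3) by (intro that[of h]) auto
qed

section \<open>Comparison of Radon measures\<close>

lemma radon_measure_sets: "radon_measure \<nu> \<Longrightarrow> sets \<nu> = sets borel"
  by (simp add: radon_measure_def)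

text \<open>A bump between a compact \<open>K \<subseteq> B\<close> and an open \<open>U\<close>
  around \<open>B\<close> compares the two measures; inner regularity of \<open>\<rho>\<close> and
  outer regularity of \<open>\<nu>\<close> then meet at \<open>B\<close>. The assumption is
  integrability, since this is what is known of a competing representing measure in the uniqueness
  claim.\<close>

lemma radon_measure_le:
  fixes \<nu> \<rho> :: "'a::t4_space measure"
  assumes lc: "locally_compact_space (euclidean :: 'a topology)"
    and \<nu>: "radon_measure \<nu>" and \<rho>: "radon_measure \<rho>"
    and int: "\<And>h. h \<in> C0_space \<Longrightarrow> integrable \<nu> h" "\<And>h. h \<in> C0_space \<Longrightarrow> integrable \<rho> h"
    and le: "\<And>h. h \<in> C0_space \<Longrightarrow> (\<And>x. 0 \<le> h x) \<Longrightarrow> (\<integral>x. h x \<partial>\<rho>) \<le> (\<integral>x. h x \<partial>\<nu>)"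
    and B: "B \<in> sets borel"
  shows "emeasure \<rho> B \<le> emeasure \<nu> B"
proof -
  note sets = radon_measure_sets[OF \<nu>] radon_measure_sets[OF \<rho>]
  have "emeasure \<rho> K \<le> emeasure \<nu> U" if K: "compact K" "K \<subseteq> U" and U: "open U" for K U
  proof -
    obtain h :: "'a \<Rightarrow> real" where h: "h \<in> C0_space" "\<And>x. 0 \<le> h x" "\<And>x. h x \<le> 1"
      "\<And>x. x \<in> K \<Longrightarrow> h x = 1" "\<And>x. x \<notin> U \<Longrightarrow> h x = 0"
      using C0_bump[OF lc K(1) U K(2)] by blast
    have "emeasure \<rho> K = (\<integral>\<^sup>+x. indicator K x \<partial>\<rho>)"
      using K by (simp add: sets borel_compact)
    also have "\<dots> \<le> (\<integral>\<^sup>+x. ennreal (h x) \<partial>\<rho>)"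
      using h by (intro nn_integral_mono) (auto simp: indicator_def)
    also have "\<dots> = ennreal (\<integral>x. h x \<partial>\<rho>)"
      using h int by (intro nn_integral_eq_integral) auto
    also have "\<dots> \<le> ennreal (\<integral>x. h x \<partial>\<nu>)"
      using h by (intro ennreal_leI le)
    also have "\<dots> = (\<integral>\<^sup>+x. ennreal (h x) \<partial>\<nu>)"
      using h int by (intro nn_integral_eq_integral[symmetric]) auto
    also have "\<dots> \<le> (\<integral>\<^sup>+x. indicator U x \<partial>\<nu>)"
      using h by (intro nn_integral_mono) (auto simp: indicator_def)
    also have "\<dots> = emeasure \<nu> U"
      using U by (simp add: sets)
    finally show ?thesis .
  qed
  then have "(SUP K\<in>{K. K \<subseteq> B \<and> compact K}. emeasure \<rho> K) \<le> (INF U\<in>{U. B \<subseteq> U \<and> open U}. emeasure \<nu> U)"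
    by (intro SUP_least INF_greatest) auto
  moreover have "emeasure \<rho> B = (SUP K\<in>{K. K \<subseteq> B \<and> compact K}. emeasure \<rho> K)"
    using \<rho> B by (simp add: radon_measure_def)
  moreover have "emeasure \<nu> B = (INF U\<in>{U. B \<subseteq> U \<and> open U}. emeasure \<nu> U)"
    using \<nu> B unfolding radon_measure_def by blast
  ultimately show ?thesis
    by metis
qed

lemma radon_measure_eqI:
  fixes \<nu> \<rho> :: "'a::t4_space measure"
  assumes lc: "locally_compact_space (euclidean :: 'a topology)"
    and \<nu>: "radon_measure \<nu>" and \<rho>: "radon_measure \<rho>"
    and int: "\<And>h. h \<in> C0_space \<Longrightarrow> integrable \<nu> h" "\<And>h. h \<in> C0_space \<Longrightarrow> integrable \<rho> h"
    and eq: "\<And>h. h \<in> C0_space \<Longrightarrow> (\<integral>x. h x \<partial>\<nu>) = (\<integral>x. h x \<partial>\<rho>)"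
  shows "\<nu> = \<rho>"
proof (rule measure_eqI)
  show "sets \<nu> = sets \<rho>"
    by (simp add: radon_measure_sets[OF \<nu>] radon_measure_sets[OF \<rho>])
  show "emeasure \<nu> B = emeasure \<rho> B" if "B \<in> sets \<nu>" for B
  proof -
    have B: "B \<in> sets borel"
      using that by (simp add: radon_measure_sets[OF \<nu>])
    show ?thesis
      using radon_measure_le[OF lc \<nu> \<rho> int _ B] radon_measure_le[OF lc \<rho> \<nu> int(2,1) _ B] eq
      by (intro antisym) auto
  qed
qed

lemma integrable_bounded_continuous:
  fixes f :: "'a::topological_space \<Rightarrow> real"
  assumes "finite_measure \<nu>" "sets \<nu> = sets borel" "continuous_on UNIV f" "bounded (range f)"
  shows "integrable \<nu> f"
proof -
  obtain M where "\<And>x. \<bar>f x\<bar> \<le> M"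
    using assms(4) by (auto simp: bounded_iff)
  moreover have "f \<in> borel_measurable \<nu>"
    using borel_measurable_continuous_onI[OF assms(3)] measurable_cong_sets[OF assms(2) refl] by blast
  ultimately show ?thesis
    by (intro finite_measure.integrable_const_bound[OF assms(1), of _ M]) auto
qed

section \<open>Representation of the content integral\<close>

text \<open>The layer of \<open>f\<close> between the heights \<open>k * \<epsilon>\<close> and
  \<open>(k + 1) * \<epsilon>\<close>, as a continuous function with values in the interval from
  \<open>0\<close> to \<open>\<epsilon>\<close>.\<close>

definition slice :: "('a \<Rightarrow> real) \<Rightarrow> real \<Rightarrow> nat \<Rightarrow> 'a \<Rightarrow> real" where
  "slice f \<epsilon> k x = max 0 (min \<epsilon> (f x - real k * \<epsilon>))"

lemma sum_slice:
  assumes "0 < \<epsilon>" "0 \<le> f x"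
  shows "(\<Sum>k<n. slice f \<epsilon> k x) = min (f x) (real n * \<epsilon>)"
proof (induction n)
  case 0
  then show ?case using assms by simp
next
  case (Suc n)
  then show ?case using assms by (auto simp: slice_def algebra_simps max_def min_def)
qed

lemma slice_nonneg: "0 \<le> slice f \<epsilon> k x"
  and slice_le: "0 < \<epsilon> \<Longrightarrow> slice f \<epsilon> k x \<le> \<epsilon>"
  and slice_eq_0: "f x \<le> real k * \<epsilon> \<Longrightarrow> slice f \<epsilon> k x = 0"
  and slice_eq: "0 < \<epsilon> \<Longrightarrow> real (Suc k) * \<epsilon> \<le> f x \<Longrightarrow> slice f \<epsilon> k x = \<epsilon>"
  by (auto simp: slice_def algebra_simps)

lemma continuous_slice: "continuous_on UNIV f \<Longrightarrow> continuous_on UNIV (slice f \<epsilon> k)"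
  unfolding slice_def by (intro continuous_intros)

lemma bounded_slice: "0 < \<epsilon> \<Longrightarrow> bounded (range (slice f \<epsilon> k))"
  using slice_nonneg[of f \<epsilon> k] slice_le[of \<epsilon> f k] by (intro boundedI[of _ \<epsilon>]) auto

text \<open>Captures what the content integral and the integral against \<open>\<nu>\<close> share,
  so that one interlacing lemma yields both inequalities by exchanging their roles.\<close>

definition additive_on_bcontinuous :: "(('a::topological_space \<Rightarrow> real) \<Rightarrow> real) \<Rightarrow> bool" where
  "additive_on_bcontinuous J \<longleftrightarrow> J (\<lambda>_. 0) = 0 \<and>
     (\<forall>g h. continuous_on UNIV g \<longrightarrow> bounded (range g) \<longrightarrow> continuous_on UNIV h \<longrightarrow> bounded (range h) \<longrightarrow>
        J (\<lambda>x. g x + h x) = J g + J h)"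

lemma additive_on_bcontinuousD:
  "additive_on_bcontinuous J \<Longrightarrow> continuous_on UNIV g \<Longrightarrow> bounded (range g) \<Longrightarrow> continuous_on UNIV h \<Longrightarrow>
    bounded (range h) \<Longrightarrow> J (\<lambda>x. g x + h x) = J g + J h"
  by (simp add: additive_on_bcontinuous_def)

text \<open>The content of a regular open set and the measure of its interior or closure differ by
  boundary mass. Comparing the integrals of consecutive slices, rather than of the same slice,
  absorbs this mass at the cost of a single slice.\<close>

lemma slice_interlace:
  fixes J J' :: "('a::topological_space \<Rightarrow> real) \<Rightarrow> real"
  assumes f: "continuous_on UNIV f" "\<And>x. 0 \<le> f x" "\<And>x. f x \<le> real n * \<epsilon>" and "0 < \<epsilon>" "0 < n"
    and J: "additive_on_bcontinuous J" and J': "additive_on_bcontinuous J'"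
    and bottom: "J (slice f \<epsilon> 0) \<le> C" and top: "\<And>k. 0 \<le> J' (slice f \<epsilon> k)"
    and step: "\<And>k. J (slice f \<epsilon> (Suc k)) \<le> J' (slice f \<epsilon> k)"
  shows "J f \<le> J' f + C"
proof -
  have split: "I f = (\<Sum>k<n. I (slice f \<epsilon> k))"
    if I: "additive_on_bcontinuous I"
    for I :: "('a \<Rightarrow> real) \<Rightarrow> real"
  proof -
    have "I (\<lambda>x. \<Sum>k<i. slice f \<epsilon> k x) = (\<Sum>k<i. I (slice f \<epsilon> k)) \<and>
            bounded (range (\<lambda>x. \<Sum>k<i. slice f \<epsilon> k x))" for i
    proof (induction i)
      case 0
      then show ?case using I by (simp add: additive_on_bcontinuous_def image_constant_conv)
    next
      case (Suc i)
      have "continuous_on UNIV (\<lambda>x. \<Sum>k<i. slice f \<epsilon> k x)"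
        by (intro continuous_on_sum continuous_slice f)
      then show ?case
        using Suc additive_on_bcontinuousD[OF I, of "\<lambda>x. \<Sum>k<i. slice f \<epsilon> k x" "slice f \<epsilon> i"]
          continuous_slice[OF f(1), of \<epsilon> i] bounded_slice[OF \<open>0 < \<epsilon>\<close>, of f i]
          bounded_plus_comp[of "\<lambda>x. \<Sum>k<i. slice f \<epsilon> k x" UNIV "slice f \<epsilon> i"]
        by simp
    qed
    moreover have "(\<lambda>x. \<Sum>k<n. slice f \<epsilon> k x) = f"
      using sum_slice[OF \<open>0 < \<epsilon>\<close>, of f] f(2,3) by (simp add: min_absorb1)
    ultimately show ?thesis by metis
  qed
  obtain l where n: "n = Suc l"
    using \<open>0 < n\<close> gr0_implies_Suc by blast
  \<comment> \<open>The bottom slice of \<open>J\<close> is paid for by \<open>C\<close>, slice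
    \<open>k + 1\<close> of \<open>J\<close> is paired with slice \<open>k\<close> of
    \<open>J'\<close>, and the unpaired top slice of \<open>J'\<close> is dropped as
    nonnegative.\<close>
  have "J f = J (slice f \<epsilon> 0) + (\<Sum>k<l. J (slice f \<epsilon> (Suc k)))"
    unfolding split[OF J] n by (rule sum.lessThan_Suc_shift)
  also have "\<dots> \<le> C + (\<Sum>k<l. J' (slice f \<epsilon> k))"
    by (intro add_mono bottom sum_mono step)
  also have "\<dots> \<le> C + J' f"
    unfolding split[OF J'] n using top[of l] by simp
  finally show ?thesis by simp
qed

lemma content_integral_le_cell:
  assumes \<mu>: "regular_content \<mu>" and V: "regular_open V"
    and f: "continuous_on UNIV f" "bounded (range f)" "\<And>x. f x \<le> c" "\<And>x. x \<notin> V \<Longrightarrow> f x = 0"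
  shows "content_integral \<mu> UNIV f \<le> c * \<mu> V"
proof -
  have "content_integral \<mu> (- closure V) f = 0"
    using f(4) closure_subset[of V]
    by (intro content_integral_eq_0[OF \<mu> regular_open_Compl_closure[OF V]]) auto
  moreover have "content_integral \<mu> V f \<le> content_integral \<mu> V (\<lambda>_. c)"
    using f by (intro content_integral_mono[OF \<mu> V]) (auto simp: image_constant_conv)
  ultimately show ?thesis
    using content_integral_complement[OF \<mu> V f(1,2)] content_integral_const[OF \<mu> V, of c] by simp
qed

lemma content_integral_ge_cell:
  assumes \<mu>: "regular_content \<mu>" and V: "regular_open V"
    and f: "continuous_on UNIV f" "bounded (range f)" "\<And>x. 0 \<le> f x" "\<And>x. x \<in> V \<Longrightarrow> f x = c"
  shows "c * \<mu> V \<le> content_integral \<mu> UNIV f"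
  using content_integral_complement[OF \<mu> V f(1,2)] content_integral_const[OF \<mu> V, of c]
    content_integral_cong[of V f "\<lambda>_. c" \<mu>] f(4)
    content_integral_nonneg[OF \<mu> regular_open_Compl_closure[OF V] f(1,2,3)]
  by simp

theorem content_integral_representation:
  fixes m :: "'a::t4_space set \<Rightarrow> real"
  assumes m: "regular_content m"
  obtains \<nu> where "radon_measure \<nu>" "finite_measure \<nu>"
    "\<And>f. f \<in> C0_space \<Longrightarrow> content_integral m UNIV f = (\<integral>x. f x \<partial>\<nu>)"
proof -
  obtain \<nu> where \<nu>: "radon_measure \<nu>" and fin: "finite_measure \<nu>"
    and opn: "\<And>U. open U \<Longrightarrow> emeasure \<nu> U = inner_content m U"
    and closure_ge: "\<And>R. precompact_regular_open R \<Longrightarrow> m R \<le> measure \<nu> (closure R)"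
    using content_radon_measure_exists[OF m] by blast
  interpret finite_measure \<nu> by (rule fin)
  note sets = radon_measure_sets[OF \<nu>]
  note intb = integrable_bounded_continuous[OF fin sets]
  let ?I = "content_integral m UNIV" and ?J = "\<lambda>f. \<integral>x. f x \<partial>\<nu>"
  have addI: "additive_on_bcontinuous ?I"
    using content_integral_add[OF m regular_open_UNIV] content_integral_const[OF m regular_open_UNIV, of 0]
    by (simp add: additive_on_bcontinuous_def)
  have addJ: "additive_on_bcontinuous ?J"
    unfolding additive_on_bcontinuous_def using intb by (auto intro!: Bochner_Integration.integral_add)
  have pos: "?I f = ?J f" if f: "f \<in> C0_space" "\<And>x. 0 \<le> f x" for f
  proof (rule eq_of_close)
    fix \<epsilon> :: real assume "\<epsilon> > 0"
    note cont = C0_continuous[OF f(1)]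
    note cs = continuous_slice[OF cont, of \<epsilon>] and bs = bounded_slice[OF \<open>\<epsilon> > 0\<close>, of f]
    note intS = intb[OF cs bs]
    obtain M where M: "\<And>x. f x \<le> M"
      using C0_bounded[OF f(1)] by (auto simp: bounded_iff abs_le_iff)
    obtain n where n: "M / \<epsilon> < real n"
      using reals_Archimedean2 by blast
    have "0 \<le> M"
      using f(2) M order_trans by blast
    then have "0 < n"
      using n \<open>\<epsilon> > 0\<close> by (metis divide_nonneg_pos gr0I not_less of_nat_0)
    have le_n: "f x \<le> real n * \<epsilon>" for x
      using M[of x] n \<open>\<epsilon> > 0\<close> by (simp add: field_simps)
    \<comment> \<open>\<open>V t\<close> is the regular open substitute for a superlevel set. It
      lies between the strict and the weak superlevel set, so its content is caught between their
      measures.\<close>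
    define V where "V t = interior (closure {x. t < f x})" for t
    have V: "regular_open (V t)" for t
      unfolding V_def by (rule regular_open_interior_closure)
    have opnL: "open {x. t < f x}" for t
      by (intro open_Collect_less continuous_on_const cont)
    have V_upper: "V t \<subseteq> {x. t \<le> f x}" and closure_V: "closure (V t) \<subseteq> {x. t \<le> f x}" for t
    proof -
      have "closed {x. t \<le> f x}"
        by (intro closed_Collect_le continuous_on_const cont)
      then have "closure {x. t < f x} \<subseteq> {x. t \<le> f x}"
        by (intro closure_minimal) auto
      then show "V t \<subseteq> {x. t \<le> f x}"
        unfolding V_def using interior_subset by blast
      then show "closure (V t) \<subseteq> {x. t \<le> f x}"
        using \<open>closed {x. t \<le> f x}\<close> by (rule closure_minimal)
    qed
    have V_lower: "{x. t < f x} \<subseteq> V t" for t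
      unfolding V_def using opnL by (simp add: closure_subset interior_maximal)
    have measL: "{x. t < f x} \<in> sets \<nu>" "{x. t \<le> f x} \<in> sets \<nu>" for t
      using opnL[of t] closed_Collect_le[OF continuous_on_const cont, of t] by (auto simp: sets)
    have le_V: "measure \<nu> {x. t < f x} \<le> m (V t)" for t
      using inner_content_le[OF m V V_lower, of t] content_nonneg[OF m V, of t]
      unfolding opn[OF opnL, symmetric] emeasure_eq_measure by simp
    \<comment> \<open>Positivity of \<open>t\<close> makes the weak superlevel set compact. At
      \<open>t = 0\<close> the bound may fail through content at infinity, so the bottom slice has
      to be estimated separately.\<close>
    have V_le: "m (V t) \<le> measure \<nu> {x. t \<le> f x}" if "0 < t" for t
    proof -
      have "compact (closure (V t))"
        using C0_compact_level[OF f(1) \<open>0 < t\<close>] closure_V[of t]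
        by (metis closed_closure compact_Int_closed inf.absorb2)
      then have "m (V t) \<le> measure \<nu> (closure (V t))"
        using V by (intro closure_ge) (simp add: precompact_regular_open_def)
      also have "\<dots> \<le> measure \<nu> {x. t \<le> f x}"
        using closure_V measL by (intro finite_measure_mono)
      finally show ?thesis .
    qed
    have intL: "integrable \<nu> (\<lambda>x. \<epsilon> * indicator {x. t < f x} x)"
      "integrable \<nu> (\<lambda>x. \<epsilon> * indicator {x. t \<le> f x} x)" for t
      using measL[of t] by (auto intro!: integrable_mult_right integrable_real_indicator simp: less_top[symmetric])
    have upperI: "?I (slice f \<epsilon> k) \<le> \<epsilon> * m (V (real k * \<epsilon>))" for k
      by (rule content_integral_le_cell[OF m V cs bs slice_le[OF \<open>\<epsilon> > 0\<close>] slice_eq_0])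
         (use V_lower in \<open>auto simp: not_less[symmetric]\<close>)
    have lowerI: "\<epsilon> * m (V (real (Suc k) * \<epsilon>)) \<le> ?I (slice f \<epsilon> k)" for k
      by (rule content_integral_ge_cell[OF m V cs bs slice_nonneg slice_eq[OF \<open>\<epsilon> > 0\<close>]])
         (use V_upper in auto)
    have upperJ: "?J (slice f \<epsilon> k) \<le> \<epsilon> * measure \<nu> {x. real k * \<epsilon> < f x}" for k
    proof -
      have "?J (slice f \<epsilon> k) \<le> (\<integral>x. \<epsilon> * indicator {x. real k * \<epsilon> < f x} x \<partial>\<nu>)"
        using slice_le[OF \<open>\<epsilon> > 0\<close>, of f k] slice_eq_0[of f _ k \<epsilon>]
        by (intro integral_mono intS intL) (auto simp: indicator_def not_less)
      then show ?thesis
        using measL by simp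
    qed
    have lowerJ: "\<epsilon> * measure \<nu> {x. real (Suc k) * \<epsilon> \<le> f x} \<le> ?J (slice f \<epsilon> k)" for k
    proof -
      have "(\<integral>x. \<epsilon> * indicator {x. real (Suc k) * \<epsilon> \<le> f x} x \<partial>\<nu>) \<le> ?J (slice f \<epsilon> k)"
        using slice_nonneg[of f \<epsilon> k] slice_eq[OF \<open>\<epsilon> > 0\<close>, of k f]
        by (intro integral_mono intS intL) (auto simp: indicator_def)
      then show ?thesis
        using measL by simp
    qed
    have nnI: "0 \<le> ?I (slice f \<epsilon> k)" for k
      by (rule content_integral_nonneg[OF m regular_open_UNIV cs bs slice_nonneg])
    have nnJ: "0 \<le> ?J (slice f \<epsilon> k)" for k
      by (rule Bochner_Integration.integral_nonneg) (rule slice_nonneg)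
    \<comment> \<open>Either total mass bounds the bottom slice of its own integral after scaling by
      \<open>\<epsilon>\<close>; the maximum serves both directions.\<close>
    define C where "C = max (m UNIV) (measure \<nu> UNIV)"
    have "?I f \<le> ?J f + \<epsilon> * C"
    proof (rule slice_interlace[OF cont f(2) le_n \<open>\<epsilon> > 0\<close> \<open>0 < n\<close> addI addJ _ nnJ])
      show "?I (slice f \<epsilon> 0) \<le> \<epsilon> * C"
        using upperI[of 0] content_mono[OF m V regular_open_UNIV, of 0] \<open>\<epsilon> > 0\<close>
        by (auto simp: C_def intro: order_trans mult_left_mono)
      \<comment> \<open>Both slices touch at the height \<open>(k + 1) * \<epsilon>\<close>: the
        upper one vanishes below it, the lower one equals \<open>\<epsilon>\<close> above it, and
        \<open>V_le\<close> links the content and the measure at this level.\<close>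
      show "?I (slice f \<epsilon> (Suc k)) \<le> ?J (slice f \<epsilon> k)" for k
      proof -
        have "\<epsilon> * m (V (real (Suc k) * \<epsilon>)) \<le> \<epsilon> * measure \<nu> {x. real (Suc k) * \<epsilon> \<le> f x}"
          using \<open>\<epsilon> > 0\<close> by (intro mult_left_mono V_le) auto
        then show ?thesis
          using upperI[of "Suc k"] lowerJ[of k] by linarith
      qed
    qed
    moreover have "?J f \<le> ?I f + \<epsilon> * C"
    proof (rule slice_interlace[OF cont f(2) le_n \<open>\<epsilon> > 0\<close> \<open>0 < n\<close> addJ addI _ nnI])
      have "measure \<nu> {x. 0 < f x} \<le> C"
        using finite_measure_mono[of "{x. 0 < f x}" UNIV] by (auto simp: C_def sets)
      then have "\<epsilon> * measure \<nu> {x. 0 < f x} \<le> \<epsilon> * C"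
        using \<open>\<epsilon> > 0\<close> by (intro mult_left_mono) auto
      then show "?J (slice f \<epsilon> 0) \<le> \<epsilon> * C"
        using upperJ[of 0] by simp
      show "?J (slice f \<epsilon> (Suc k)) \<le> ?I (slice f \<epsilon> k)" for k
      proof -
        have "\<epsilon> * measure \<nu> {x. real (Suc k) * \<epsilon> < f x} \<le> \<epsilon> * m (V (real (Suc k) * \<epsilon>))"
          using \<open>\<epsilon> > 0\<close> by (intro mult_left_mono le_V) auto
        then show ?thesis
          using upperJ[of "Suc k"] lowerI[of k] by linarith
      qed
    qed
    ultimately show "\<bar>?I f - ?J f\<bar> \<le> \<epsilon> * C"
      by (simp add: abs_le_iff)
  qed
  have "?I f = ?J f" if f: "f \<in> C0_space" for f
  proof -
    define p where "p x = max 0 (f x)" for x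
    define q where "q x = max 0 (- f x)" for x
    have cont: "continuous_on UNIV p" "continuous_on UNIV q"
      unfolding p_def q_def by (intro continuous_intros C0_continuous[OF f])+
    have pq: "p \<in> C0_space" "q \<in> C0_space"
      by (intro C0_dominated[OF f] cont; simp add: p_def q_def)+
    have bq: "bounded (range (\<lambda>x. - 1 * q x))"
      by (rule bounded_range_dominated[OF C0_bounded[OF pq(2)]]) simp
    have f_eq: "f = (\<lambda>x. p x + - 1 * q x)"
      by (auto simp: p_def q_def max_def)
    have "?I f = ?I p + - 1 * ?I q"
      unfolding f_eq content_integral_cmult[OF m regular_open_UNIV cont(2) C0_bounded[OF pq(2)], symmetric]
      by (rule additive_on_bcontinuousD[OF addI]) (auto intro!: continuous_intros cont C0_bounded pq simp del: mult_minus1 simp: bq[simplified])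
    moreover have "?J f = ?J p + - 1 * ?J q"
      unfolding f_eq using intb[OF cont(1) C0_bounded[OF pq(1)]] intb[OF cont(2) C0_bounded[OF pq(2)]]
      by simp
    moreover have "?I p = ?J p" "?I q = ?J q"
      by (intro pos pq; simp add: p_def q_def)+
    ultimately show ?thesis by simp
  qed
  with \<nu> fin show thesis
    using that by blast
qed

lemma C0_scale:
  assumes "f \<in> C0_space"
  shows "(\<lambda>x. c * f x) \<in> C0_space"
proof -
  have "\<exists>K. compact K \<and> (\<forall>x. x \<notin> K \<longrightarrow> \<bar>c * f x\<bar> \<le> \<epsilon>)" if e: "0 < \<epsilon>" for \<epsilon>
  proof -
    have "0 < \<epsilon> / (\<bar>c\<bar> + 1)"
      using e by simp
    then obtain K where K: "compact K" "\<forall>x. x \<notin> K \<longrightarrow> \<bar>f x\<bar> \<le> \<epsilon> / (\<bar>c\<bar> + 1)"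
      using assms unfolding C0_space_def by blast
    have "\<bar>c * f x\<bar> \<le> \<epsilon>" if "x \<notin> K" for x
    proof -
      have "\<bar>c\<bar> * \<bar>f x\<bar> \<le> (\<bar>c\<bar> + 1) * (\<epsilon> / (\<bar>c\<bar> + 1))"
        using K(2) that by (intro mult_mono) auto
      then show ?thesis
        by (simp add: abs_mult)
    qed
    with K(1) show ?thesis by blast
  qed
  moreover have "bounded (range (\<lambda>x. c * f x))"
    using bounded_scaling[OF C0_bounded[OF assms], of c] by (simp add: image_image)
  ultimately show ?thesis
    using C0_continuous[OF assms] by (auto simp: C0_space_def intro: continuous_intros)
qed

text \<open>Truncation makes \<open>f\<close> bounded but not small at infinity; multiplying by a
  bump that equals \<open>1\<close> on \<open>K\<close> achieves the rest without changing the
  values on \<open>K\<close>.\<close>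

lemma C0_agreeing_on_compact:
  fixes f :: "'a::t4_space \<Rightarrow> real"
  assumes lc: "locally_compact_space (euclidean :: 'a topology)"
    and f: "continuous_on UNIV f" and K: "compact K"
  obtains g where "g \<in> C0_space" "\<And>x. x \<in> K \<Longrightarrow> g x = f x"
proof -
  obtain h :: "'a \<Rightarrow> real" where h: "h \<in> C0_space" "\<And>x. 0 \<le> h x" "\<And>x. x \<in> K \<Longrightarrow> h x = 1"
    by (rule C0_bump[OF lc K open_UNIV subset_UNIV]) blast
  have "compact (f ` K)"
    using f K continuous_on_subset compact_continuous_image by blast
  then have "bounded (f ` K)"
    by (rule compact_imp_bounded)
  then obtain M where M: "0 < M" "\<And>x. x \<in> K \<Longrightarrow> \<bar>f x\<bar> \<le> M"
    by (auto simp: bounded_pos)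
  define g where "g x = h x * max (- M) (min M (f x))" for x
  have "\<bar>g x\<bar> \<le> \<bar>M * h x\<bar>" for x
    using mult_left_mono[of "\<bar>max (- M) (min M (f x))\<bar>" M "h x"] h(2)[of x] M(1)
    by (auto simp: g_def abs_mult mult.commute)
  moreover have "continuous_on UNIV g"
    unfolding g_def by (intro continuous_intros f C0_continuous[OF h(1)])
  ultimately have "g \<in> C0_space"
    by (intro C0_dominated[OF C0_scale[OF h(1), of M]])
  moreover have "g x = f x" if "x \<in> K" for x
    using h(3)[OF that] M(2)[OF that] by (auto simp: g_def)
  ultimately show thesis
    by (rule that)
qed

section \<open>Densities with respect to a Radon measure\<close>

text \<open>On the set where the Radon-Nikodym density exceeds \<open>1\<close>, the integral of the
  excess is the difference of the two measures, which domination makes \<open>0\<close> in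
  \<open>ennreal\<close>. So the density is at most \<open>1\<close> almost everywhere, and clipping
  it gives bounds at every point.\<close>

lemma bounded_density_exists:
  assumes fin: "finite_measure \<nu>" "finite_measure \<rho>" and sets: "sets \<rho> = sets \<nu>"
    and le: "\<And>B. B \<in> sets \<nu> \<Longrightarrow> emeasure \<rho> B \<le> emeasure \<nu> B"
  obtains g :: "'a \<Rightarrow> real" where "g \<in> borel_measurable \<nu>" "\<And>x. 0 \<le> g x" "\<And>x. g x \<le> 1"
    "\<rho> = density \<nu> (\<lambda>x. ennreal (g x))"
proof -
  interpret finite_measure \<nu> by (rule fin)
  have "absolutely_continuous \<nu> \<rho>"
    using le sets unfolding absolutely_continuous_def null_sets_def by fastforce
  then obtain h where h[measurable]: "h \<in> borel_measurable \<nu>" and \<rho>: "density \<nu> h = \<rho>"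
    using Radon_Nikodym[OF _ sets] by blast
  define A where "A = {x \<in> space \<nu>. 1 < h x}"
  have A[measurable]: "A \<in> sets \<nu>"
    unfolding A_def by measurable
  have "(\<integral>\<^sup>+x. h x * indicator A x - indicator A x \<partial>\<nu>)
          = (\<integral>\<^sup>+x. h x * indicator A x \<partial>\<nu>) - (\<integral>\<^sup>+x. indicator A x \<partial>\<nu>)"
  proof (rule nn_integral_diff)
    show "(\<integral>\<^sup>+x. indicator A x \<partial>\<nu>) \<noteq> \<infinity>"
      by (simp only: nn_integral_indicator[OF A]) simp
    show "AE x in \<nu>. indicator A x \<le> h x * indicator A x"
      by (auto simp: A_def indicator_def)
  qed measurable
  also have "\<dots> = emeasure \<rho> A - emeasure \<nu> A"
    using A by (simp add: \<rho>[symmetric] emeasure_density)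
  also have "\<dots> = 0"
    using le[OF A] finite_measure.emeasure_finite[OF fin(2), of A]
    by (simp add: diff_eq_0_iff_ennreal less_top)
  finally have "AE x in \<nu>. h x * indicator A x - indicator A x = 0"
    by (subst (asm) nn_integral_0_iff_AE) auto
  moreover have "AE x in \<nu>. x \<in> space \<nu>"
    by simp
  ultimately have AE: "AE x in \<nu>. h x \<le> 1"
  proof eventually_elim
    case (elim x)
    show ?case
    proof (rule ccontr)
      assume "\<not> h x \<le> 1"
      then have "1 < h x" "h x - 1 = 0"
        using elim by (auto simp: A_def)
      then show False
        by (auto simp: diff_eq_0_iff_ennreal)
    qed
  qed
  define g where "g x = enn2real (min 1 (h x))" for x
  have fin1: "min 1 (h x) < top" for x
    by (simp add: min_less_iff_disj)
  have g: "ennreal (g x) = min 1 (h x)" for x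
    unfolding g_def using fin1[of x] by simp
  have "ennreal (g x) \<le> ennreal 1" for x
    by (simp add: g)
  then have "g x \<le> 1" for x
    by (subst (asm) ennreal_le_iff) auto
  moreover have gm: "g \<in> borel_measurable \<nu>"
    unfolding g_def by measurable
  moreover have "\<rho> = density \<nu> (\<lambda>x. ennreal (g x))"
    unfolding \<rho>[symmetric]
    by (rule density_cong) (use AE gm in \<open>auto simp: g min_def\<close>)
  moreover have "0 \<le> g x" for x
    by (simp add: g_def)
  ultimately show thesis
    using that by blast
qed

lemma radon_measure_density:
  fixes \<nu> :: "'a::t2_space measure" and g :: "'a \<Rightarrow> real"
  assumes \<nu>: "radon_measure \<nu>" "finite_measure \<nu>"
    and g[measurable]: "g \<in> borel_measurable \<nu>" and bd: "\<And>x. 0 \<le> g x" "\<And>x. g x \<le> C"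
  shows "radon_measure (density \<nu> (\<lambda>x. ennreal (g x)))"
    and "finite_measure (density \<nu> (\<lambda>x. ennreal (g x)))"
proof -
  interpret finite_measure \<nu> by (rule \<nu>)
  note sets = radon_measure_sets[OF \<nu>(1)]
  let ?\<rho> = "density \<nu> (\<lambda>x. ennreal (g x))"
  have "0 \<le> C"
    using bd order_trans by blast
  have le: "emeasure ?\<rho> B \<le> ennreal (C * measure \<nu> B)" if B: "B \<in> sets \<nu>" for B
  proof -
    have "emeasure ?\<rho> B = (\<integral>\<^sup>+x. ennreal (g x) * indicator B x \<partial>\<nu>)"
      using B by (simp add: emeasure_density)
    also have "\<dots> \<le> (\<integral>\<^sup>+x. ennreal C * indicator B x \<partial>\<nu>)"
      using bd by (intro nn_integral_mono mult_right_mono ennreal_leI) auto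
    also have "\<dots> = ennreal (C * measure \<nu> B)"
      using B \<open>0 \<le> C\<close> by (simp add: nn_integral_cmult_indicator emeasure_eq_measure ennreal_mult)
    finally show ?thesis .
  qed
  show fin: "finite_measure ?\<rho>"
    using le[OF sets.top] by (intro finite_measureI) (auto simp: top_unique)
  show "radon_measure ?\<rho>"
  proof (rule radon_measure_dominated[OF \<nu> fin])
    show "sets ?\<rho> = sets borel"
      by (simp add: sets)
    show "measure ?\<rho> B \<le> C * measure \<nu> B" if "B \<in> sets borel" for B
    proof -
      have "ennreal (measure ?\<rho> B) \<le> ennreal (C * measure \<nu> B)"
        using le[of B] that unfolding finite_measure.emeasure_eq_measure[OF fin] by (simp add: sets)
      then show ?thesis
        using \<open>0 \<le> C\<close> by (subst (asm) ennreal_le_iff) auto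
    qed
  qed
qed

lemma C0_mult_integrable:
  fixes \<nu> :: "'a::topological_space measure"
  assumes fin: "finite_measure \<nu>" and sets: "sets \<nu> = sets borel" and f: "f \<in> C0_space"
    and g: "g \<in> borel_measurable \<nu>" "\<And>x. \<bar>g x\<bar> \<le> C"
  shows "integrable \<nu> (\<lambda>x. f x * g x)"
proof (rule Bochner_Integration.integrable_bound)
  have int: "integrable \<nu> f"
    using integrable_bounded_continuous[OF fin sets C0_continuous[OF f] C0_bounded[OF f]] .
  then show "integrable \<nu> (\<lambda>x. C * f x)"
    by simp
  show "(\<lambda>x. f x * g x) \<in> borel_measurable \<nu>"
    using int g(1) by measurable
  have "\<bar>f x\<bar> * \<bar>g x\<bar> \<le> \<bar>C\<bar> * \<bar>f x\<bar>" for x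
    using mult_left_mono[of "\<bar>g x\<bar>" "\<bar>C\<bar>" "\<bar>f x\<bar>"] g(2)[of x] by (simp add: mult.commute)
  then show "AE x in \<nu>. norm (f x * g x) \<le> norm (C * f x)"
    by (simp add: abs_mult)
qed

text \<open>Both densities define finite Radon measures, which agree because they integrate
  \<open>C0_space\<close> alike; uniqueness of densities finishes. Applied both to the sum of the
  densities over a partition and to the uniqueness of the liminal density.\<close>

lemma AE_eq_of_C0_integrals:
  fixes \<nu> :: "'a::t4_space measure" and g g' :: "'a \<Rightarrow> real"
  assumes lc: "locally_compact_space (euclidean :: 'a topology)"
    and \<nu>: "radon_measure \<nu>" "finite_measure \<nu>"
    and g: "g \<in> borel_measurable \<nu>" "\<And>x. 0 \<le> g x" "\<And>x. g x \<le> C"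
    and g': "g' \<in> borel_measurable \<nu>" "\<And>x. 0 \<le> g' x" "\<And>x. g' x \<le> C"
    and eq: "\<And>f. f \<in> C0_space \<Longrightarrow> (\<integral>x. f x * g x \<partial>\<nu>) = (\<integral>x. f x * g' x \<partial>\<nu>)"
  shows "AE x in \<nu>. g x = g' x"
proof -
  interpret finite_measure \<nu> by (rule \<nu>)
  note sets = radon_measure_sets[OF \<nu>(1)]
  note rad = radon_measure_density[OF \<nu> g] radon_measure_density[OF \<nu> g']
  have int: "integrable (density \<nu> (\<lambda>x. ennreal (k x))) f"
    if "f \<in> C0_space" "radon_measure (density \<nu> (\<lambda>x. ennreal (k x)))"
       "finite_measure (density \<nu> (\<lambda>x. ennreal (k x)))" for f and k :: "'a \<Rightarrow> real"
    using that by (intro integrable_bounded_continuous C0_continuous C0_bounded radon_measure_sets)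
  have "density \<nu> (\<lambda>x. ennreal (g x)) = density \<nu> (\<lambda>x. ennreal (g' x))"
  proof (rule radon_measure_eqI[OF lc rad(1,3)])
    fix f :: "'a \<Rightarrow> real" assume f: "f \<in> C0_space"
    then have fm: "f \<in> borel_measurable \<nu>"
      using integrable_bounded_continuous[OF \<nu>(2) sets C0_continuous[OF f] C0_bounded[OF f]] by simp
    show "integral\<^sup>L (density \<nu> (\<lambda>x. ennreal (g x))) f = integral\<^sup>L (density \<nu> (\<lambda>x. ennreal (g' x))) f"
      using eq[OF f] g g' fm by (simp add: integral_real_density mult.commute)
  qed (use int rad in auto)
  then have "AE x in \<nu>. ennreal (g x) = ennreal (g' x)"
    using g(1) g'(1) by (subst (asm) density_unique_iff) auto
  then show ?thesis
    by eventually_elim (simp add: g(2) g'(2))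
qed

section \<open>Liminal densities\<close>

lemma cell_density_exists:
  fixes \<mu> :: "'a::t4_space set \<Rightarrow> real"
  assumes lc: "locally_compact_space (euclidean :: 'a topology)" and \<mu>: "regular_content \<mu>"
    and \<nu>: "radon_measure \<nu>" "finite_measure \<nu>"
    and rep: "\<And>f. f \<in> C0_space \<Longrightarrow> content_integral \<mu> UNIV f = (\<integral>x. f x \<partial>\<nu>)"
    and R: "regular_open R"
  obtains g :: "'a \<Rightarrow> real" where "g \<in> borel_measurable \<nu>" "\<And>x. 0 \<le> g x" "\<And>x. g x \<le> 1"
    "\<And>f. f \<in> C0_space \<Longrightarrow> content_integral \<mu> R f = (\<integral>x. f x * g x \<partial>\<nu>)"
    "AE x in \<nu>. x \<notin> closure R \<longrightarrow> g x = 0"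
proof -
  interpret finite_measure \<nu> by (rule \<nu>)
  note sets = radon_measure_sets[OF \<nu>(1)]
  obtain \<rho> where \<rho>: "radon_measure \<rho>" "finite_measure \<rho>"
    and rep_\<rho>: "\<And>f. f \<in> C0_space \<Longrightarrow> content_integral (\<lambda>Q. \<mu> (Q \<inter> R)) UNIV f = (\<integral>x. f x \<partial>\<rho>)"
    using content_integral_representation[OF regular_content_restrict[OF \<mu> R]] by blast
  have rep_R: "content_integral \<mu> R f = (\<integral>x. f x \<partial>\<rho>)" if "f \<in> C0_space" for f
    using rep_\<rho>[OF that] content_integral_restrict[OF \<mu> R C0_continuous[OF that] C0_bounded[OF that]]
    by simp
  have int: "integrable \<sigma> f" if "f \<in> C0_space" "radon_measure \<sigma>" "finite_measure \<sigma>"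
    for \<sigma> and f :: "'a \<Rightarrow> real"
    using that by (intro integrable_bounded_continuous C0_continuous C0_bounded radon_measure_sets)
  have le: "emeasure \<rho> B \<le> emeasure \<nu> B" if "B \<in> sets \<nu>" for B
  proof (rule radon_measure_le[OF lc \<nu>(1) \<rho>(1)])
    fix h :: "'a \<Rightarrow> real" assume h: "h \<in> C0_space" "\<And>x. 0 \<le> h x"
    \<comment> \<open>The gap between the integrals against \<open>\<nu>\<close> and
      \<open>\<rho>\<close> is the content integral over the complementary cell, which is
      nonnegative for nonnegative \<open>h\<close>.\<close>
    have "0 \<le> content_integral \<mu> (- closure R) h"
      using h by (intro content_integral_nonneg \<mu> regular_open_Compl_closure R C0_continuous C0_bounded)
    then show "(\<integral>x. h x \<partial>\<rho>) \<le> (\<integral>x. h x \<partial>\<nu>)"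
      using content_integral_complement[OF \<mu> R C0_continuous[OF h(1)] C0_bounded[OF h(1)]]
      by (simp add: rep[OF h(1)] rep_R[OF h(1)])
  qed (use int \<nu> \<rho> that sets in auto)
  obtain g :: "'a \<Rightarrow> real" where g[measurable]: "g \<in> borel_measurable \<nu>"
    and g01: "\<And>x. 0 \<le> g x" "\<And>x. g x \<le> 1" and \<rho>_eq: "\<rho> = density \<nu> (\<lambda>x. ennreal (g x))"
    using bounded_density_exists[OF \<nu>(2) \<rho>(2) _ le] sets radon_measure_sets[OF \<rho>(1)] by metis
  have "content_integral \<mu> R f = (\<integral>x. f x * g x \<partial>\<nu>)" if f: "f \<in> C0_space" for f
    using int[OF f \<nu>] g01 unfolding rep_R[OF f] \<rho>_eq
    by (subst integral_real_density) (auto simp: mult.commute)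
  moreover have "AE x in \<nu>. x \<notin> closure R \<longrightarrow> g x = 0"
  proof -
    \<comment> \<open>A bump supported in the exterior of \<open>R\<close> is zero on
      \<open>R\<close>, so its integral over \<open>R\<close> vanishes. Inner regularity extends
      this from compact sets to the whole exterior.\<close>
    have "emeasure \<rho> K = 0" if K: "K \<subseteq> - closure R" "compact K" for K
    proof -
      obtain h :: "'a \<Rightarrow> real" where h: "h \<in> C0_space" "\<And>x. 0 \<le> h x" "\<And>x. h x \<le> 1"
        "\<And>x. x \<in> K \<Longrightarrow> h x = 1" "\<And>x. x \<notin> - closure R \<Longrightarrow> h x = 0"
        using C0_bump[OF lc K(2) _ K(1)] by (metis closed_closure open_Compl)
      have "emeasure \<rho> K = (\<integral>\<^sup>+x. indicator K x \<partial>\<rho>)"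
        using K by (simp add: radon_measure_sets[OF \<rho>(1)] borel_compact)
      also have "\<dots> \<le> (\<integral>\<^sup>+x. ennreal (h x) \<partial>\<rho>)"
        using h by (intro nn_integral_mono) (auto simp: indicator_def)
      also have "\<dots> = ennreal (\<integral>x. h x \<partial>\<rho>)"
        using h int[OF h(1) \<rho>] by (intro nn_integral_eq_integral) auto
      also have "\<dots> = 0"
      proof -
        have "content_integral \<mu> R h = 0"
          using h(5) closure_subset[of R] by (intro content_integral_eq_0[OF \<mu> R]) auto
        then show ?thesis
          by (simp add: rep_R[OF h(1)])
      qed
      finally show ?thesis by simp
    qed
    then have "(SUP K\<in>{K. K \<subseteq> - closure R \<and> compact K}. emeasure \<rho> K) = 0"
      by (intro antisym SUP_least) auto
    then have "emeasure \<rho> (- closure R) = 0"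
      using \<rho>(1) unfolding radon_measure_def by simp
    have [measurable]: "- closure R \<in> sets \<nu>"
      by (simp add: sets)
    have meas: "(\<lambda>x. ennreal (g x) * indicator (- closure R) x) \<in> borel_measurable \<nu>"
      by measurable
    from \<open>emeasure \<rho> (- closure R) = 0\<close>
    have "(\<integral>\<^sup>+x. ennreal (g x) * indicator (- closure R) x \<partial>\<nu>) = 0"
      by (simp add: \<rho>_eq emeasure_density sets)
    then have "AE x in \<nu>. ennreal (g x) * indicator (- closure R) x = 0"
      using meas by (subst (asm) nn_integral_0_iff_AE) auto
    then show ?thesis
      by eventually_elim (use g01(1) antisym in \<open>auto simp: indicator_def split: if_splits\<close>)
  qed
  ultimately show thesis
    using that g g01 by blast
qed

lemma partition_density_sum:
  fixes \<mu> :: "'a::t4_space set \<Rightarrow> real"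
  assumes lc: "locally_compact_space (euclidean :: 'a topology)" and \<mu>: "regular_content \<mu>"
    and \<nu>: "radon_measure \<nu>" "finite_measure \<nu>"
    and rep: "\<And>f. f \<in> C0_space \<Longrightarrow> content_integral \<mu> UNIV f = (\<integral>x. f x \<partial>\<nu>)"
    and P: "regular_partition \<P>"
    and g: "\<And>P. P \<in> \<P> \<Longrightarrow> g P \<in> borel_measurable \<nu>" "\<And>P x. P \<in> \<P> \<Longrightarrow> 0 \<le> g P x"
      "\<And>P x. P \<in> \<P> \<Longrightarrow> g P x \<le> 1"
      "\<And>P f. P \<in> \<P> \<Longrightarrow> f \<in> C0_space \<Longrightarrow> content_integral \<mu> P f = (\<integral>x. f x * g P x \<partial>\<nu>)"
  shows "AE x in \<nu>. (\<Sum>P\<in>\<P>. g P x) = 1"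
proof (rule AE_eq_of_C0_integrals[OF lc \<nu>])
  note sets = radon_measure_sets[OF \<nu>(1)]
  show "(\<lambda>x. \<Sum>P\<in>\<P>. g P x) \<in> borel_measurable \<nu>"
    by (intro borel_measurable_sum g)
  \<comment> \<open>One constant has to bound both the sum, which is at most
    \<open>card \<P>\<close>, and the competing density \<open>1\<close>.\<close>
  show "(\<Sum>P\<in>\<P>. g P x) \<le> real (card \<P>) + 1" for x
    using sum_bounded_above[of \<P> "\<lambda>P. g P x" 1] g(3) by auto
  fix f :: "'a \<Rightarrow> real" assume f: "f \<in> C0_space"
  have "(\<integral>x. f x * (\<Sum>P\<in>\<P>. g P x) \<partial>\<nu>) = (\<integral>x. (\<Sum>P\<in>\<P>. f x * g P x) \<partial>\<nu>)"
    by (simp add: sum_distrib_left)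
  also have "\<dots> = (\<Sum>P\<in>\<P>. \<integral>x. f x * g P x \<partial>\<nu>)"
    using g by (intro Bochner_Integration.integral_sum C0_mult_integrable[OF \<nu>(2) sets f, where C = 1]) auto
  also have "\<dots> = (\<Sum>P\<in>\<P>. content_integral \<mu> P f)"
    using g(4) f by simp
  also have "\<dots> = (\<integral>x. f x \<partial>\<nu>)"
    using content_integral_partition[OF \<mu> P C0_continuous[OF f] C0_bounded[OF f]] rep[OF f] by simp
  finally show "(\<integral>x. f x * (\<Sum>P\<in>\<P>. g P x) \<partial>\<nu>) = (\<integral>x. f x * 1 \<partial>\<nu>)"
    by simp
qed (auto intro: sum_nonneg g)

text \<open>The bounds and the values on \<open>R\<close> and off \<open>closure R\<close> are
  required at every point, not almost everywhere, so that the integrand splits pointwise into its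
  part on \<open>R\<close> and its part on \<open>frontier R\<close>.\<close>

definition cell_density ::
    "('a::topological_space set \<Rightarrow> real) \<Rightarrow> 'a measure \<Rightarrow> 'a set \<Rightarrow> ('a \<Rightarrow> real) \<Rightarrow> bool" where
  "cell_density \<mu> \<nu> R g \<longleftrightarrow> g \<in> borel_measurable \<nu> \<and> (\<forall>x. 0 \<le> g x \<and> g x \<le> 1) \<and>
     (\<forall>f\<in>C0_space. content_integral \<mu> R f = (\<integral>x. f x * g x \<partial>\<nu>)) \<and>
     (\<forall>x. x \<in> R \<longrightarrow> g x = 1) \<and> (\<forall>x. x \<notin> closure R \<longrightarrow> g x = 0)"

lemma normalized_cell_density_exists:
  fixes \<mu> :: "'a::t4_space set \<Rightarrow> real"
  assumes lc: "locally_compact_space (euclidean :: 'a topology)" and \<mu>: "regular_content \<mu>"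
    and \<nu>: "radon_measure \<nu>" "finite_measure \<nu>"
    and rep: "\<And>f. f \<in> C0_space \<Longrightarrow> content_integral \<mu> UNIV f = (\<integral>x. f x \<partial>\<nu>)"
    and R: "regular_open R"
  shows "\<exists>g. cell_density \<mu> \<nu> R g"
proof -
  note sets = radon_measure_sets[OF \<nu>(1)]
  obtain g :: "'a \<Rightarrow> real" where g[measurable]: "g \<in> borel_measurable \<nu>"
    and g01: "\<And>x. 0 \<le> g x" "\<And>x. g x \<le> 1"
    and g_rep: "\<And>f. f \<in> C0_space \<Longrightarrow> content_integral \<mu> R f = (\<integral>x. f x * g x \<partial>\<nu>)"
    and g_off: "AE x in \<nu>. x \<notin> closure R \<longrightarrow> g x = 0"
    using cell_density_exists[OF lc \<mu> \<nu> rep R] by blast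
  obtain h :: "'a \<Rightarrow> real" where h: "h \<in> borel_measurable \<nu>"
    and h01: "\<And>x. 0 \<le> h x" "\<And>x. h x \<le> 1"
    and h_rep: "\<And>f. f \<in> C0_space \<Longrightarrow> content_integral \<mu> (- closure R) f = (\<integral>x. f x * h x \<partial>\<nu>)"
    and h_off: "AE x in \<nu>. x \<notin> closure (- closure R) \<longrightarrow> h x = 0"
    using cell_density_exists[OF lc \<mu> \<nu> rep regular_open_Compl_closure[OF R]] by blast
  define k where "k P = (if P = R then g else h)" for P
  have "AE x in \<nu>. (\<Sum>P\<in>{R, - closure R}. k P x) = 1"
    by (rule partition_density_sum[OF lc \<mu> \<nu> rep regular_partition_complement[OF R]])
       (use g h g01 h01 g_rep h_rep in \<open>auto simp: k_def\<close>)
  then have "AE x in \<nu>. g x + h x = 1"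
    using neq_Compl_closure[of R] by (simp add: k_def)
  \<comment> \<open>By regularity \<open>R\<close> is exactly the exterior of the complementary cell
    \<open>- closure R\<close>. There the complementary density \<open>h\<close> vanishes almost
    everywhere, which leaves \<open>1\<close> for \<open>g\<close>.\<close>
  then have g_on: "AE x in \<nu>. x \<in> R \<longrightarrow> g x = 1"
    using h_off
  proof eventually_elim
    case (elim x)
    then show ?case
      using regular_open_eq_Compl_closure_Compl_closure[OF R] by auto
  qed
  \<comment> \<open>A change on a null set, turning the almost sure values of \<open>g\<close> into
    pointwise ones.\<close>
  define g' where "g' x = (if x \<in> R then 1 else if x \<in> closure R then g x else 0)" for x
  have [measurable]: "R \<in> sets \<nu>" "closure R \<in> sets \<nu>"
    using regular_open_imp_open[OF R] by (auto simp: sets)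
  have g': "g' \<in> borel_measurable \<nu>"
    unfolding g'_def by measurable
  have AE_eq: "AE x in \<nu>. g x = g' x"
    using g_on g_off by eventually_elim (auto simp: g'_def)
  have "content_integral \<mu> R f = (\<integral>x. f x * g' x \<partial>\<nu>)" if f: "f \<in> C0_space" for f
  proof -
    have "f \<in> borel_measurable \<nu>"
      using integrable_bounded_continuous[OF \<nu>(2) sets C0_continuous[OF f] C0_bounded[OF f]] by simp
    then show ?thesis
      unfolding g_rep[OF f] using g' AE_eq by (intro integral_cong_AE) auto
  qed
  moreover have "0 \<le> g' x \<and> g' x \<le> 1" for x
    using g01 by (simp add: g'_def)
  moreover have "g' x = 0" if "x \<notin> closure R" for x
    using that closure_subset[of R] by (auto simp: g'_def)
  ultimately show ?thesis
    using g' by (intro exI[of _ g']) (auto simp: cell_density_def g'_def)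
qed

theorem theorem6p5:
  fixes \<mu> :: "'a::t4_space set \<Rightarrow> real"
  assumes "locally_compact_space (euclidean :: 'a topology)"
    and "regular_content \<mu>"
    and "\<mu> UNIV = 1"
  shows "(\<exists>!\<nu>. radon_measure \<nu> \<and> represents_content \<nu> \<mu>) \<and>
    (\<forall>\<nu>. radon_measure \<nu> \<and> represents_content \<nu> \<mu> \<longrightarrow>
      (\<exists>\<phi>. liminal_representation \<mu> \<nu> \<phi> \<and>
        (\<forall>\<psi>. liminal_representation \<mu> \<nu> \<psi> \<longrightarrow> liminal_equal \<nu> \<phi> \<psi>) \<and>
        (\<forall>f R. continuous_on UNIV f \<longrightarrow> precompact_regular_open R \<longrightarrow>
           liminal_formula \<mu> \<nu> \<phi> f R)))"
proof -
  note lc = assms(1) and \<mu> = assms(2)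
  obtain \<nu> where \<nu>: "radon_measure \<nu>" "finite_measure \<nu>"
    and rep: "\<And>f. f \<in> C0_space \<Longrightarrow> content_integral \<mu> UNIV f = (\<integral>x. f x \<partial>\<nu>)"
    using content_integral_representation[OF \<mu>] by blast
  interpret finite_measure \<nu> by (rule \<nu>)
  note sets = radon_measure_sets[OF \<nu>(1)]
  have int: "integrable \<nu> f" if "f \<in> C0_space" for f :: "'a \<Rightarrow> real"
    using integrable_bounded_continuous[OF \<nu>(2) sets C0_continuous[OF that] C0_bounded[OF that]] .
  have \<nu>_rep: "represents_content \<nu> \<mu>"
    using int rep by (simp add: represents_content_def)
  have unique: "\<rho> = \<nu>" if "radon_measure \<rho>" "represents_content \<rho> \<mu>" for \<rho>
    using that(2) rep by (intro radon_measure_eqI[OF lc that(1) \<nu>(1)] int) (auto simp: represents_content_def)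
  have "\<forall>R. \<exists>g. regular_open R \<longrightarrow> cell_density \<mu> \<nu> R g"
    using normalized_cell_density_exists[OF lc \<mu> \<nu> rep] by simp
  from choice[OF this] obtain \<phi> where "\<And>R. regular_open R \<Longrightarrow> cell_density \<mu> \<nu> R (\<phi> R)"
    by auto
  then have \<phi>: "\<And>R. regular_open R \<Longrightarrow> \<phi> R \<in> borel_measurable \<nu>"
    "\<And>R x. regular_open R \<Longrightarrow> 0 \<le> \<phi> R x \<and> \<phi> R x \<le> 1"
    "\<And>R f. regular_open R \<Longrightarrow> f \<in> C0_space \<Longrightarrow> content_integral \<mu> R f = (\<integral>x. f x * \<phi> R x \<partial>\<nu>)"
    "\<And>R x. regular_open R \<Longrightarrow> x \<in> R \<Longrightarrow> \<phi> R x = 1"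
    "\<And>R x. regular_open R \<Longrightarrow> x \<notin> closure R \<Longrightarrow> \<phi> R x = 0"
    by (auto simp: cell_density_def)
  have fr: "frontier R \<in> sets \<nu>" for R :: "'a set"
    by (simp add: sets)
  have ind_meas: "(\<lambda>x. indicator (frontier R) x * \<phi> R x) \<in> borel_measurable \<nu>" if "regular_open R" for R
    using \<phi>(1)[OF that] fr[of R] by measurable
  have formula: "liminal_formula \<mu> \<nu> \<phi> f R" if f: "f \<in> C0_space" and R: "regular_open R" for f R
  proof -
    have op: "open R"
      by (rule regular_open_imp_open[OF R])
    have split: "f x * \<phi> R x = indicator R x *\<^sub>R f x + indicator (frontier R) x *\<^sub>R (f x * \<phi> R x)" for x
      using \<phi>(4,5)[OF R, of x] op closure_subset[of R]
      by (auto simp: indicator_def frontier_def interior_open)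
    have "integrable \<nu> (\<lambda>x. indicator R x *\<^sub>R f x)"
      using int[OF f] op by (intro integrable_mult_indicator) (auto simp: sets)
    moreover have "integrable \<nu> (\<lambda>x. indicator (frontier R) x *\<^sub>R (f x * \<phi> R x))"
      using C0_mult_integrable[OF \<nu>(2) sets f \<phi>(1)[OF R], of 1] \<phi>(2)[OF R] fr
      by (intro integrable_mult_indicator) auto
    ultimately show ?thesis
      unfolding liminal_formula_def \<phi>(3)[OF R f] set_lebesgue_integral_def
      by (subst Bochner_Integration.integral_cong[OF refl split]) (rule Bochner_Integration.integral_add)
  qed
  have formula_continuous: "liminal_formula \<mu> \<nu> \<phi> f R"
    if f: "continuous_on UNIV f" and R: "precompact_regular_open R" for f R
  proof -
    \<comment> \<open>The content integral sees only \<open>R\<close> and the other two integrals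
      only \<open>closure R\<close>, so \<open>f\<close> may be replaced by a function in
      \<open>C0_space\<close> agreeing with it on that compact set.\<close>
    obtain g where g: "g \<in> C0_space" "\<And>x. x \<in> closure R \<Longrightarrow> g x = f x"
      using C0_agreeing_on_compact[OF lc f] R unfolding precompact_regular_open_def by blast
    have eq: "indicator R x *\<^sub>R g x = indicator R x *\<^sub>R f x"
      "indicator (frontier R) x *\<^sub>R (g x * \<phi> R x) = indicator (frontier R) x *\<^sub>R (f x * \<phi> R x)" for x
      using g(2)[of x] closure_subset[of R] by (auto simp: indicator_def frontier_def)
    have "content_integral \<mu> R g = content_integral \<mu> R f"
      using g(2) closure_subset[of R] by (intro content_integral_cong) auto
    then show ?thesis
      using formula[OF g(1)] R
      by (simp only: liminal_formula_def set_lebesgue_integral_def eq precompact_regular_open_def)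
  qed
  have "liminal_density_structure \<nu> \<phi>"
    unfolding liminal_density_structure_def
  proof (intro conjI allI impI)
    fix R :: "'a set" assume R: "regular_open R"
    show "set_integrable \<nu> (frontier R) (\<phi> R)"
      unfolding set_integrable_def using ind_meas[OF R] \<phi>(2)[OF R]
      by (intro integrable_const_bound[of _ 1]) (auto simp: indicator_def)
    show "\<forall>x\<in>frontier R. \<phi> R x \<in> {0..1}"
      using \<phi>(2)[OF R] by simp
  next
    fix \<P> :: "'a set set" assume P: "regular_partition \<P>"
    then have reg: "regular_open P" if "P \<in> \<P>" for P
      using that by (simp add: regular_partition_iff)
    have "AE x in \<nu>. (\<Sum>P\<in>\<P>. \<phi> P x) = 1"
      using \<phi> reg by (intro partition_density_sum[OF lc \<mu> \<nu> rep P]) auto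
    then show "AE x in \<nu>. x \<in> (\<Union>R\<in>\<P>. frontier R) \<longrightarrow> (\<Sum>R\<in>\<P>. indicator (frontier R) x * \<phi> R x) = 1"
    proof eventually_elim
      case (elim x)
      show ?case
      proof
        assume x: "x \<in> (\<Union>R\<in>\<P>. frontier R)"
        \<comment> \<open>Since \<open>x\<close> lies on the frontier of some cell, it belongs to no
          cell. If it is not on \<open>frontier Q\<close> either, it is outside
          \<open>closure Q\<close>, where \<open>\<phi> Q\<close> is \<open>0\<close>; so the
          indicators do not alter the sum.\<close>
        have "indicator (frontier Q) x * \<phi> Q x = \<phi> Q x" if Q: "Q \<in> \<P>" for Q
        proof (cases "x \<in> frontier Q")
          case False
          moreover have "x \<notin> Q"
            using x Q regular_partition_frontier_notin[OF P] by blast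
          ultimately have "x \<notin> closure Q"
            using regular_open_imp_open[OF reg[OF Q]] by (auto simp: frontier_def interior_open)
          then show ?thesis
            using \<phi>(5)[OF reg[OF Q]] by simp
        qed simp
        then have "(\<Sum>R\<in>\<P>. indicator (frontier R) x * \<phi> R x) = (\<Sum>R\<in>\<P>. \<phi> R x)"
          by (rule sum.cong[OF refl])
        with elim show "(\<Sum>R\<in>\<P>. indicator (frontier R) x * \<phi> R x) = 1"
          by simp
      qed
    qed
  qed
  moreover have "\<mu> R = measure \<nu> R + (LINT x:frontier R|\<nu>. \<phi> R x)" if R: "precompact_regular_open R" for R
  proof -
    have reg: "regular_open R"
      using R by (simp add: precompact_regular_open_def)
    \<comment> \<open>The constant \<open>1\<close> need not vanish at infinity, hence the version
      of the formula for continuous functions on cells with compact closure.\<close>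
    have "liminal_formula \<mu> \<nu> \<phi> (\<lambda>_. 1) R"
      using R by (intro formula_continuous) auto
    then show ?thesis
      using content_integral_const[OF \<mu> reg, of 1] regular_open_imp_open[OF reg]
      by (simp add: liminal_formula_def set_lebesgue_integral_def sets)
  qed
  ultimately have rep_\<phi>: "liminal_representation \<mu> \<nu> \<phi>"
    using formula by (simp add: liminal_representation_def)
  have "liminal_equal \<nu> \<phi> \<psi>" if \<psi>: "liminal_representation \<mu> \<nu> \<psi>" for \<psi>
    unfolding liminal_equal_def
  proof (intro allI impI)
    fix R :: "'a set" assume R: "regular_open R"
    have \<psi>_int: "integrable \<nu> (\<lambda>x. indicator (frontier R) x * \<psi> R x)"
      and \<psi>01: "\<And>x. x \<in> frontier R \<Longrightarrow> 0 \<le> \<psi> R x \<and> \<psi> R x \<le> 1"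
      using \<psi> R unfolding liminal_representation_def liminal_density_structure_def set_integrable_def
      by auto
    have "AE x in \<nu>. indicator (frontier R) x * \<phi> R x = indicator (frontier R) x * \<psi> R x"
    proof (rule AE_eq_of_C0_integrals[OF lc \<nu> ind_meas[OF R], where C = 1])
      fix f :: "'a \<Rightarrow> real" assume f: "f \<in> C0_space"
      have "liminal_formula \<mu> \<nu> \<psi> f R"
        using \<psi> f R by (simp add: liminal_representation_def)
      \<comment> \<open>Both formulas have the same content integral and the same integral over
        \<open>R\<close>, so the frontier integrals agree for every test function. The extensions by
        zero are then compared as densities on the whole space.\<close>
      with formula[OF f R]
      show "(\<integral>x. f x * (indicator (frontier R) x * \<phi> R x) \<partial>\<nu>) = (\<integral>x. f x * (indicator (frontier R) x * \<psi> R x) \<partial>\<nu>)"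
        by (simp add: liminal_formula_def set_lebesgue_integral_def mult.left_commute)
    qed (use \<psi>_int \<psi>01 \<phi>(2)[OF R] in \<open>auto simp: indicator_def\<close>)
    then show "AE x in \<nu>. x \<in> frontier R \<longrightarrow> \<phi> R x = \<psi> R x"
      by eventually_elim auto
  qed
  with rep_\<phi> formula_continuous have "\<exists>\<phi>. liminal_representation \<mu> \<nu> \<phi> \<and>
      (\<forall>\<psi>. liminal_representation \<mu> \<nu> \<psi> \<longrightarrow> liminal_equal \<nu> \<phi> \<psi>) \<and>
      (\<forall>f R. continuous_on UNIV f \<longrightarrow> precompact_regular_open R \<longrightarrow> liminal_formula \<mu> \<nu> \<phi> f R)"
    by blast
  \<comment> \<open>Any representing Radon measure equals the constructed one, so the liminal claims
    transfer to it.\<close>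
  with \<nu>(1) \<nu>_rep unique show ?thesis
    by (intro conjI ex1I[of _ \<nu>]) (metis | blast)+
qed

end
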